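(* Let $P(\lambda)$ be a strictly regular $n\times n$ matrix polynomial of degree $d$ over a field $\mathbb{F}$, with Smith form $S(\lambda)=\mathrm{diag}(s_1(\lambda),\dots,s_n(\lambda))$. Assume that all irreducible divisors of $P(\lambda)$ have degree $1$ or degree $k$, where $k\ge 2$. Let $\mathcal{F}_1$ and $\mathcal{F}_k$ be the multisets of all the $\mathbb{F}$-irreducible factors (counted with multiplicity) of $s_1,\dots,s_n$ of degree $1$ and of degree $k$, respectively, and let $\mathbf{d}_{\mathcal{F}_1}(S)\in\mathbb{N}^n$ be the vector whose $i$th entry is the number of degree-$1$ irreducible factors (with multiplicity) of $s_i$. Organize the degree-$k$ factors (the elements of $\mathcal{F}_k$) into a vector of $n$ polynomials $\mathbf{q}(\lambda)=(q_1(\lambda),\dots,q_n(\lambda))$ by the stacking procedure described in the context, so that the vector of numbers of degree-$k$ irreducible factors of $q_1,\dots,q_n$ is $1$-homogeneous. Define the degree gaps $g_i:=d-\deg q_i$ (some of which may be negative) and the gap vector $\mathbf{g}:=(g_1,\dots,g_n)$. Then $P(\lambda)$ has a triangularization of degree $d$ if and only if $\mathbf{d}_{\mathcal{F}_1}(S)\succeq\mathbf{g}$ (i.e. $\mathbf{d}_{\mathcal{F}_1}(S)$ majorizes $\mathbf{g}$).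
   Context: A matrix polynomial over $\mathbb{F}$ is a matrix with entries in $\mathbb{F}[\lambda]$. An $n\times n$ matrix polynomial of degree $d$ (grade taken equal to degree) is strictly regular if its coefficient of $\lambda^d$ is nonsingular. Two matrix polynomials are unimodularly equivalent if one is obtained from the other by left and right multiplication by unimodular matrix polynomials (square, nonzero constant determinant). The Smith form $\mathrm{diag}(s_1,\dots,s_n)$, with $s_i$ monic and $s_i\mid s_{i+1}$, is the canonical form under unimodular equivalence. An irreducible divisor of $P$ is a non-constant irreducible polynomial in $\mathbb{F}[\lambda]$ dividing some $s_i$. A triangularization of $P$ of degree $d$ is an upper triangular matrix polynomial of degree $d$ over $\mathbb{F}$ unimodularly equivalent to $P$. Stacking procedure: take the multiset of polynomials to be organized, append copies of the constant $1$ until the number of elements is a multiple of $n$, list the elements $a_1,a_2,\dots,a_{(q+1)n}$ in order of non-increasing degree, and set $q_i:=a_i\,a_{n+i}\,a_{2n+i}\cdots a_{qn+i}$ for $i=1,\dots,n$. (Only degrees matter for $\mathbf{g}$.) A natural vector is $1$-homogeneous if any two entries differ by at most $1$. Majorization: for $\mathbf{x},\mathbf{y}\in\mathbb{Z}^n$ with non-increasing rearrangements $\mathbf{x}',\mathbf{y}'$, $\mathbf{x}\succeq\mathbf{y}$ means $\sum_{i=1}^{\ell}x_i'\ge\sum_{i=1}^{\ell}y_i'$ for $\ell=1,\dots,n$, with equality for $\ell=n$. *)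

theory Defs
  imports
    "Jordan_Normal_Form.Determinant"
    "HOL-Computational_Algebra.Polynomial_Factorial"
begin

text \<open>
  An \<open>n \<times> n\<close> matrix polynomial over the field \<open>'a\<close> is an \<open>'a poly mat\<close> in \<open>carrier_mat n n\<close>.
  Row, column and diagonal indices run over \<open>0, \<dots>, n - 1\<close>. Vectors indexed by \<open>1, \<dots>, n\<close> are
  lists of length \<open>n\<close>.
\<close>

section \<open>Matrix polynomials\<close>

definition matpoly_coeff :: "'a::zero poly mat \<Rightarrow> nat \<Rightarrow> 'a mat" where
  "matpoly_coeff A m = map_mat (\<lambda>p. coeff p m) A"

definition has_degree :: "'a::zero poly mat \<Rightarrow> nat \<Rightarrow> bool" where
  "has_degree A d \<longleftrightarrow>
     matpoly_coeff A d \<noteq> 0\<^sub>m (dim_row A) (dim_col A) \<and>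
     (\<forall>m>d. matpoly_coeff A m = 0\<^sub>m (dim_row A) (dim_col A))"

definition strictly_regular :: "nat \<Rightarrow> nat \<Rightarrow> 'a::field poly mat \<Rightarrow> bool" where
  "strictly_regular n d P \<longleftrightarrow>
     P \<in> carrier_mat n n \<and> has_degree P d \<and> det (matpoly_coeff P d) \<noteq> 0"

definition unimodular :: "nat \<Rightarrow> 'a::field poly mat \<Rightarrow> bool" where
  "unimodular n U \<longleftrightarrow> U \<in> carrier_mat n n \<and> (\<exists>c. c \<noteq> 0 \<and> det U = [:c:])"

definition unimodularly_equivalent :: "nat \<Rightarrow> 'a::field poly mat \<Rightarrow> 'a poly mat \<Rightarrow> bool" where
  "unimodularly_equivalent n A B \<longleftrightarrow>
     A \<in> carrier_mat n n \<and> B \<in> carrier_mat n n \<and>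
     (\<exists>U V. unimodular n U \<and> unimodular n V \<and> B = U * A * V)"

text \<open>
  All \<open>n\<close> invariant polynomials are required to be monic, hence nonzero, so this is the Smith form
  of a regular matrix polynomial (nonzero determinant).
\<close>

definition is_smith_form :: "nat \<Rightarrow> 'a::field poly mat \<Rightarrow> 'a poly mat \<Rightarrow> bool" where
  "is_smith_form n P S \<longleftrightarrow>
     unimodularly_equivalent n P S \<and> diagonal_mat S \<and>
     (\<forall>i<n. lead_coeff (S $$ (i, i)) = 1) \<and>
     (\<forall>i. Suc i < n \<longrightarrow> S $$ (i, i) dvd S $$ (Suc i, Suc i))"

definition irreducible_divisor :: "nat \<Rightarrow> 'a::field poly mat \<Rightarrow> 'a poly \<Rightarrow> bool" where
  "irreducible_divisor n P p \<longleftrightarrow>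
     irreducible p \<and> (\<exists>S. is_smith_form n P S \<and> (\<exists>i<n. p dvd S $$ (i, i)))"

definition is_triangularization :: "nat \<Rightarrow> nat \<Rightarrow> 'a::field poly mat \<Rightarrow> 'a poly mat \<Rightarrow> bool" where
  "is_triangularization n d P T \<longleftrightarrow>
     upper_triangular T \<and> has_degree T d \<and> unimodularly_equivalent n P T"


section \<open>Irreducible factors with multiplicity\<close>

text \<open>
  The library's \<open>prime_factorization\<close> is not available for \<open>'a poly\<close> over an arbitrary
  \<open>'a :: field\<close>, since that type is not an instance of \<open>factorial_semiring\<close>. The factors are
  normalized to be monic, and the multiset is only meaningful for \<open>p \<noteq> 0\<close>.
\<close>

definition monic_factorization :: "'a::field poly \<Rightarrow> 'a poly multiset \<Rightarrow> bool" where
  "monic_factorization p A \<longleftrightarrow>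
     (\<forall>q\<in>#A. irreducible q \<and> lead_coeff q = 1) \<and> p = smult (lead_coeff p) (prod_mset A)"

definition irreducible_factors :: "'a::field poly \<Rightarrow> 'a poly multiset" where
  "irreducible_factors p = (THE A. monic_factorization p A)"

lemma monic_factorization_exists:
  fixes p :: "'a::field poly"
  assumes "p \<noteq> 0"
  shows "\<exists>A. monic_factorization p A"
  using assms
proof (induction "degree p" arbitrary: p rule: less_induct)
  case less
  show ?case
  proof (cases "degree p = 0")
    case True
    then obtain c where "p = [:c:]" by (rule degree_eq_zeroE)
    then have "monic_factorization p {#}"
      by (simp add: monic_factorization_def)
    then show ?thesis ..
  next
    case nonconst: False
    show ?thesis
    proof (cases "irreducible p")
      case True
      let ?c = "lead_coeff p"
      have c: "?c \<noteq> 0" using less.prems by simp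
      have u: "is_unit [:inverse ?c:]" using c by (simp add: is_unit_const_poly_iff dvd_field_iff)
      have "smult (inverse ?c) p = [:inverse ?c:] * p" by simp
      then have "irreducible (smult (inverse ?c) p)"
        using True u by (metis irreducible_mult_unit_left)
      then have "monic_factorization p {#smult (inverse ?c) p#}"
        using c by (simp add: monic_factorization_def)
      then show ?thesis ..
    next
      case False
      have "\<not> is_unit p" using nonconst by (metis is_unit_iff_degree less.prems)
      with False less.prems obtain a b where ab: "p = a * b" "\<not> is_unit a" "\<not> is_unit b"
        unfolding irreducible_def by blast
      have nz: "a \<noteq> 0" "b \<noteq> 0" using ab less.prems by auto
      have "degree a \<noteq> 0" "degree b \<noteq> 0" using ab nz by (auto simp: is_unit_iff_degree)
      moreover have "degree p = degree a + degree b" using ab nz by (simp add: degree_mult_eq)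
      ultimately have "degree a < degree p" "degree b < degree p" by auto
      then obtain A B where "monic_factorization a A" "monic_factorization b B"
        using less.hyps nz by blast
      then have AB: "\<forall>q\<in>#A + B. irreducible q \<and> lead_coeff q = 1"
        "a = smult (lead_coeff a) (prod_mset A)" "b = smult (lead_coeff b) (prod_mset B)"
        by (auto simp: monic_factorization_def)
      have "p = smult (lead_coeff a) (prod_mset A) * smult (lead_coeff b) (prod_mset B)"
        using ab(1) AB(2,3) by metis
      also have "\<dots> = smult (lead_coeff p) (prod_mset (A + B))"
        by (simp only: ab(1) lead_coeff_mult) (simp add: mult_ac)
      finally have "monic_factorization p (A + B)"
        using AB(1) by (simp add: monic_factorization_def)
      then show ?thesis ..
    qed
  qed
qed

lemma monic_irreducible_prod_unique:
  fixes A B :: "'a::field poly multiset"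
  assumes "\<forall>q\<in>#A. irreducible q \<and> lead_coeff q = 1"
    and "\<forall>q\<in>#B. irreducible q \<and> lead_coeff q = 1"
    and "prod_mset A = prod_mset B"
  shows "A = B"
  using assms
proof (induction A arbitrary: B)
  case empty
  have "q dvd 1" if "q \<in># B" for q using that empty.prems(3) by (metis dvd_prod_mset prod_mset_empty)
  then have "B = {#}" using empty.prems(2) by (auto simp: irreducible_def intro!: multiset_nonemptyE[of B])
  then show ?case by simp
next
  case (add a A)
  have a: "irreducible a" "lead_coeff a = 1" using add.prems(1) by auto
  have "a dvd prod_mset B" using add.prems(3) by (metis dvd_prod_mset union_single_eq_member)
  then obtain b where b: "b \<in># B" "a dvd b"
    using field_poly_irreducible_imp_prime[OF a(1)] prime_elem_dvd_prod_mset by blast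
  have bi: "irreducible b" "lead_coeff b = 1" using add.prems(2) b(1) by auto
  obtain c where c: "b = a * c" using b(2) by (rule dvdE)
  have "is_unit c" using bi(1) a(1) c by (metis irreducibleD irreducible_not_unit)
  then obtain e where e: "c = [:e:]" by (elim is_unit_polyE)
  have "b = smult e a" using c e by simp
  then have ba: "b = a" using a(2) bi(2) by (metis lead_coeff_smult mult.right_neutral smult_1_left)
  obtain B' where B': "B = add_mset a B'" using b(1) ba by (metis multi_member_split)
  have "a \<noteq> 0" using a(1) by (auto simp: irreducible_def)
  then have "prod_mset A = prod_mset B'" using add.prems(3) B' by simp
  then have "A = B'" using add.IH[of B'] add.prems(1,2) B' by simp
  then show ?case using B' by simp
qed

lemma monic_factorization_irreducible_factors:
  fixes p :: "'a::field poly"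
  assumes "p \<noteq> 0"
  shows "monic_factorization p (irreducible_factors p)"
proof -
  obtain A where A: "monic_factorization p A" using monic_factorization_exists[OF assms] ..
  have "B = A" if "monic_factorization p B" for B
  proof (rule monic_irreducible_prod_unique)
    show "prod_mset B = prod_mset A"
      using A that assms unfolding monic_factorization_def
      by (metis leading_coeff_0_iff smult_eq_iff[of "lead_coeff p" "lead_coeff p"])
  qed (use A that in \<open>auto simp: monic_factorization_def\<close>)
  with A show ?thesis unfolding irreducible_factors_def by (rule theI)
qed

lemma irreducible_factors_eqI:
  fixes p :: "'a::field poly"
  assumes "p \<noteq> 0" "monic_factorization p A"
  shows "irreducible_factors p = A"
proof (rule monic_irreducible_prod_unique)
  let ?B = "irreducible_factors p"
  have B: "monic_factorization p ?B" by (rule monic_factorization_irreducible_factors[OF assms(1)])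
  have "smult (lead_coeff p) (prod_mset ?B) = smult (lead_coeff p) (prod_mset A)"
    using B assms(2) unfolding monic_factorization_def by metis
  then have "smult (inverse (lead_coeff p)) (smult (lead_coeff p) (prod_mset ?B)) =
      smult (inverse (lead_coeff p)) (smult (lead_coeff p) (prod_mset A))" by (rule arg_cong)
  then show "prod_mset ?B = prod_mset A" using assms(1) by simp
  show "\<forall>q\<in>#?B. irreducible q \<and> lead_coeff q = 1"
    using B by (simp add: monic_factorization_def)
  show "\<forall>q\<in>#A. irreducible q \<and> lead_coeff q = 1"
    using assms(2) by (simp add: monic_factorization_def)
qed

definition factors_of_degree :: "nat \<Rightarrow> 'a::field poly \<Rightarrow> 'a poly multiset" where
  "factors_of_degree m p = filter_mset (\<lambda>q. degree q = m) (irreducible_factors p)"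

definition smith_factors :: "nat \<Rightarrow> nat \<Rightarrow> 'a::field poly mat \<Rightarrow> 'a poly multiset" where
  "smith_factors n m S = (\<Sum>i<n. factors_of_degree m (S $$ (i, i)))"

definition factor_count_vector :: "nat \<Rightarrow> nat \<Rightarrow> 'a::field poly mat \<Rightarrow> int list" where
  "factor_count_vector n m S = map (\<lambda>i. int (size (factors_of_degree m (S $$ (i, i))))) [0..<n]"


section \<open>Stacking and majorization\<close>

text \<open>
  \<open>is_stacking n F qs\<close>: the list \<open>qs\<close> arises from the multiset \<open>F\<close> by the stacking procedure.
  This is a relation because the order of equal-degree elements is left open. The bound \<open>r < n\<close>
  says that no more constants are appended than needed. If \<open>F\<close> is empty then so is \<open>a\<close>, and
  every entry of \<open>qs\<close> is the empty product \<open>1\<close>.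
\<close>

definition is_stacking :: "nat \<Rightarrow> 'a::field poly multiset \<Rightarrow> 'a poly list \<Rightarrow> bool" where
  "is_stacking n F qs \<longleftrightarrow>
     (\<exists>r a. r < n \<and> mset a = F + replicate_mset r 1 \<and> n dvd length a \<and>
        sorted_wrt (\<lambda>p q. degree p \<ge> degree q) a \<and>
        qs = map (\<lambda>i. \<Prod>j<length a div n. a ! (j * n + i)) [0..<n])"

definition one_homogeneous :: "nat list \<Rightarrow> bool" where
  "one_homogeneous xs \<longleftrightarrow> (\<forall>x\<in>set xs. \<forall>y\<in>set xs. x \<le> y + 1)"

lemma is_stacking_exists:
  assumes "n \<ge> 1"
  shows "\<exists>qs. is_stacking n F qs"
proof -
  define r where "r = (n - size F mod n) mod n"
  have r: "r < n" using assms by (simp add: r_def)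
  have "(size F + r) mod n = (size F mod n + (n - size F mod n)) mod n"
    by (simp add: r_def mod_simps)
  also have "\<dots> = 0" using assms by (simp add: mod_less_divisor less_imp_le)
  finally have dvd: "n dvd size F + r" by (rule mod_0_imp_dvd)
  obtain b where b: "mset b = F + replicate_mset r 1" using ex_mset by blast
  define a where "a = rev (sort_key degree b)"
  have "mset a = F + replicate_mset r 1" using b by (simp add: a_def)
  moreover from this have "length a = size F + r" by (metis size_mset size_union size_replicate_mset)
  moreover have "sorted_wrt (\<lambda>p q. degree p \<ge> degree q) a"
    using sorted_sort_key[of degree b] by (simp add: a_def sorted_wrt_rev sorted_wrt_map)
  ultimately show ?thesis
    using r dvd unfolding is_stacking_def by (intro exI[of _ r] exI[of _ a] exI conjI) (assumption | simp)+
qed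

lemma stacking_one_homogeneous:
  fixes F :: "'a::field poly multiset"
  assumes F: "\<forall>p\<in>#F. irreducible p \<and> lead_coeff p = 1 \<and> degree p = k"
    and k: "k \<ge> 1" and st: "is_stacking n F qs"
  shows "one_homogeneous (map (\<lambda>q. size (factors_of_degree k q)) qs)"
proof -
  from st obtain r a where a: "mset a = F + replicate_mset r 1" "n dvd length a"
      "sorted_wrt (\<lambda>p q. degree p \<ge> degree q) a"
      "qs = map (\<lambda>i. \<Prod>j<length a div n. a ! (j * n + i)) [0..<n]"
    unfolding is_stacking_def by blast
  define M where "M = length a div n"
  have len: "length a = M * n" using a(2) by (simp add: M_def)
  define J where "J i = {j. j < M \<and> degree (a ! (j * n + i)) = k}" for i
  have fin: "finite (J i)" for i by (simp add: J_def)
  have idx: "j * n + i < length a" if "j < M" "i < n" for i j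
  proof -
    have "j * n + i < Suc j * n" using that by simp
    also have "\<dots> \<le> M * n" using that by (intro mult_le_mono1) simp
    finally show ?thesis by (simp add: len)
  qed
  have elem: "a ! l = 1 \<or> a ! l \<in># F" if "l < length a" for l
  proof -
    have "a ! l \<in># F + replicate_mset r 1" using that nth_mem[OF that] by (simp flip: a(1))
    then show ?thesis by (auto split: if_splits)
  qed
  have deg: "degree (a ! l) = k" if "l \<le> l'" "l' < length a" "degree (a ! l') = k" for l l'
  proof (cases "l = l'")
    case False
    then have "degree (a ! l') \<le> degree (a ! l)"
      using sorted_wrt_nth_less[OF a(3), of l l'] that by simp
    with that k have "a ! l \<noteq> 1" by auto
    with elem[of l] that F show ?thesis by auto
  qed (use that in simp)
  have step: "card (J i) \<le> card (J i') + 1" if i: "i < n" "i' < n" for i i'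
  proof -
    have "(\<lambda>j. j - 1) ` (J i - {0}) \<subseteq> J i'"
    proof (rule image_subsetI)
      fix j assume "j \<in> J i - {0}"
      then have j: "j \<in> J i" "0 < j" by auto
      then obtain j' where j': "j = Suc j'" by (cases j) auto
      have "degree (a ! (j' * n + i')) = k"
      proof (rule deg)
        show "j' * n + i' \<le> j * n + i" using i by (simp add: j')
        show "j * n + i < length a" using j i by (intro idx) (simp_all add: J_def)
        show "degree (a ! (j * n + i)) = k" using j by (simp add: J_def)
      qed
      then show "j - 1 \<in> J i'" using j j' by (simp add: J_def)
    qed
    then have "card ((\<lambda>j. j - 1) ` (J i - {0})) \<le> card (J i')" by (rule card_mono[OF fin])
    moreover have "inj_on (\<lambda>j. j - 1) (J i - {0})" by (rule inj_onI) auto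
    ultimately have "card (J i - {0}) \<le> card (J i')" by (simp add: card_image)
    moreover have "card (J i) \<le> card (J i - {0}) + 1" by (simp add: card_Diff_singleton_if) linarith
    ultimately show ?thesis by simp
  qed
  have count: "size (factors_of_degree k (\<Prod>j<M. a ! (j * n + i))) = card (J i)" if i: "i < n" for i
  proof -
    have main: "\<exists>A. monic_factorization (\<Prod>j<m. a ! (j * n + i)) A \<and>
        lead_coeff (\<Prod>j<m. a ! (j * n + i)) = 1 \<and>
        size (filter_mset (\<lambda>q. degree q = k) A) = card {j. j < m \<and> degree (a ! (j * n + i)) = k}"
      if "m \<le> M" for m
      using that
    proof (induction m)
      case 0
      show ?case by (intro exI[of _ "{#}"]) (simp add: monic_factorization_def)
    next
      case (Suc m)
      let ?p = "\<Prod>j<m. a ! (j * n + i)" and ?b = "a ! (m * n + i)"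
      from Suc obtain A where A: "monic_factorization ?p A" "lead_coeff ?p = 1"
        "size (filter_mset (\<lambda>q. degree q = k) A) = card {j. j < m \<and> degree (a ! (j * n + i)) = k}"
        by auto
      have pA: "?p = prod_mset A" and irrA: "\<forall>q\<in>#A. irreducible q \<and> lead_coeff q = 1"
        using A(1,2) by (simp_all add: monic_factorization_def)
      from elem[of "m * n + i"] idx[of m i] i Suc.prems consider "?b = 1" | "?b \<in># F" by auto
      then show ?case
      proof cases
        case 1
        then have "{j. j < Suc m \<and> degree (a ! (j * n + i)) = k} =
            {j. j < m \<and> degree (a ! (j * n + i)) = k}"
          using k by (auto simp: less_Suc_eq)
        then show ?thesis using A 1 by (intro exI[of _ A]) simp
      next
        case 2
        then have b: "irreducible ?b" "lead_coeff ?b = 1" "degree ?b = k" using F by auto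
        have lc: "lead_coeff (\<Prod>j<Suc m. a ! (j * n + i)) = 1"
          using A(2) b(2) by (simp only: prod.lessThan_Suc lead_coeff_mult) simp
        have "(\<Prod>j<Suc m. a ! (j * n + i)) = prod_mset (add_mset ?b A)"
          using pA by (simp add: mult.commute)
        then have "monic_factorization (\<Prod>j<Suc m. a ! (j * n + i)) (add_mset ?b A)"
          using lc irrA b unfolding monic_factorization_def by (metis insert_iff set_mset_add_mset_insert smult_1_left)
        moreover have "{j. j < Suc m \<and> degree (a ! (j * n + i)) = k} =
            insert m {j. j < m \<and> degree (a ! (j * n + i)) = k}"
          using b by (auto simp: less_Suc_eq)
        ultimately show ?thesis using lc A(3) b(3) by (intro exI[of _ "add_mset ?b A"]) simp
      qed
    qed
    from main[of M] obtain A where A: "monic_factorization (\<Prod>j<M. a ! (j * n + i)) A"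
      "lead_coeff (\<Prod>j<M. a ! (j * n + i)) = 1"
      "size (filter_mset (\<lambda>q. degree q = k) A) = card (J i)" by (auto simp: J_def)
    from A(2) have "(\<Prod>j<M. a ! (j * n + i)) \<noteq> 0" by (metis lead_coeff_1 leading_coeff_0_iff zero_neq_one)
    from irreducible_factors_eqI[OF this A(1)] A(3) show ?thesis
      by (simp add: factors_of_degree_def)
  qed
  show ?thesis
    unfolding one_homogeneous_def a(4) M_def[symmetric] using step by (auto simp: count)
qed

corollary smith_factors_stacking_one_homogeneous:
  assumes "is_smith_form n P S" "k \<ge> 1" "is_stacking n (smith_factors n k S) qs"
  shows "one_homogeneous (map (\<lambda>q. size (factors_of_degree k q)) qs)"
proof (rule stacking_one_homogeneous[OF _ assms(2,3)], rule ballI)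
  fix p assume "p \<in># smith_factors n k S"
  then obtain i where i: "i < n" "p \<in># factors_of_degree k (S $$ (i, i))"
    by (auto simp: smith_factors_def set_mset_sum)
  have "S $$ (i, i) \<noteq> 0"
    using assms(1) i(1) unfolding is_smith_form_def by (metis coeff_0 zero_neq_one)
  from monic_factorization_irreducible_factors[OF this] i(2)
  show "irreducible p \<and> lead_coeff p = 1 \<and> degree p = k"
    by (auto simp: monic_factorization_def factors_of_degree_def)
qed

definition gap_vector :: "nat \<Rightarrow> 'a::zero poly list \<Rightarrow> int list" where
  "gap_vector d qs = map (\<lambda>q. int d - int (degree q)) qs"

definition nonincreasing :: "int list \<Rightarrow> int list" where
  "nonincreasing xs = rev (sort xs)"

definition majorizes :: "int list \<Rightarrow> int list \<Rightarrow> bool" where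
  "majorizes xs ys \<longleftrightarrow>
     length xs = length ys \<and>
     (\<forall>l\<in>{1..length xs}. sum_list (take l (nonincreasing xs)) \<ge> sum_list (take l (nonincreasing ys))) \<and>
     sum_list xs = sum_list ys"

end

theory Submission
  imports Defs
begin

text \<open>
  Let \<open>s\<^sub>1, \<dots>, s\<^sub>n\<close> be the diagonal of the Smith form, \<open>f\<^sub>i\<close> the number of linear factors of \<open>s\<^sub>i\<close>, \<open>m\<^sub>i\<close> the
  number of factors of degree \<open>k\<close> in the stacked polynomial \<open>q\<^sub>i\<close>, and \<open>g\<^sub>i = d - k m\<^sub>i\<close>. Since \<open>P\<close> is
  strictly regular, \<open>det P\<close> has degree \<open>n d\<close> (\<open>degree_det_strictly_regular\<close>). So a triangular matrix of
  degree \<open>d\<close> equivalent to \<open>P\<close> has diagonal entries \<open>t\<^sub>i\<close> of degree exactly \<open>d\<close>. If \<open>t\<^sub>i\<close> has \<open>c\<^sub>i\<close> factors of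
  degree 1 and \<open>e\<^sub>i\<close> of degree \<open>k\<close>, then \<open>c\<^sub>i = d - k e\<^sub>i\<close>, and the theorem becomes a statement about the
  vectors of factor counts. Both \<open>f\<close> and \<open>g\<close> are nondecreasing as given, so \<open>f\<close> majorizes \<open>g\<close> if and only if
  no prefix sum of \<open>f\<close> exceeds the prefix sum of \<open>g\<close> of the same length; the totals agree because both
  sides account for the degree \<open>n d\<close> of \<open>det P\<close>.

  Necessity. A product of \<open>l\<close> diagonal entries of \<open>T\<close> is a minor of \<open>T = X S Y\<close>, hence divisible by
  \<open>s\<^sub>1 \<cdots> s\<^sub>l\<close> (\<open>prefix_prod_dvd_triangular_diagonal\<close>). Counting linear factors gives
  \<open>f\<^sub>1 + \<dots> + f\<^sub>l \<le> l d - k (\<Sum>i\<in>I. e\<^sub>i)\<close> for every set \<open>I\<close> of \<open>l\<close> indices. The vector \<open>m\<close> is 1-homogeneous and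
  has the same sum as \<open>e\<close>, so the \<open>l\<close> largest entries of \<open>e\<close> sum to at least \<open>m\<^sub>1 + \<dots> + m\<^sub>l\<close>
  (\<open>homogeneous_prefix_le_top_sum\<close>), which is the required inequality.

  Sufficiency. The Smith form is itself triangular, and its diagonal is changed step by step. Two
  diagonal entries \<open>a, b\<close> can be replaced by \<open>a', b'\<close> whenever \<open>a' b' = a b\<close> and every common divisor of
  \<open>a\<close> and \<open>b\<close> divides both \<open>a'\<close> and \<open>b'\<close> (\<open>has_triangular_diagonal_replace_pair\<close>). This allows moving an
  irreducible factor from an entry that contains it more often to one that contains it less often
  (\<open>has_triangular_diagonal_transfer\<close>). On the vectors of counts these are unit transfers from a larger
  to a smaller entry. They lead from any vector to the 1-homogeneous \<open>m\<close> of the same sum, and from \<open>f\<close> to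
  \<open>g\<close> under the prefix sum condition (\<open>unit_transfers_reach_homogeneous\<close>,
  \<open>unit_transfers_reach_nondecreasing\<close>). In the end every diagonal entry has degree \<open>g\<^sub>i + k m\<^sub>i = d\<close>, and
  column operations reduce the entries above the diagonal to degree at most \<open>d\<close>
  (\<open>triangularization_of_constant_degree_diagonal\<close>).
\<close>


section \<open>Unimodular equivalence\<close>

lemma unimodular_mult:
  assumes "unimodular n U" "unimodular n V"
  shows "unimodular n (U * V)"
proof -
  obtain b c where "b \<noteq> 0" "det U = [:b:]" "c \<noteq> 0" "det V = [:c:]"
    using assms unfolding unimodular_def by blast
  moreover from this have "det (U * V) = [:b * c:]"
    using assms by (subst det_mult[of U n V]) (auto simp: unimodular_def)
  ultimately show ?thesis using assms unfolding unimodular_def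
    by (intro conjI exI[of _ "b * c"]) auto
qed

lemma unimodular_addrow_mat: "k \<noteq> l \<Longrightarrow> unimodular n (addrow_mat n q k l)"
  by (auto simp: unimodular_def det_addrow_mat one_pCons)

lemma unimodular_inverse:
  fixes U :: "'a::field poly mat"
  assumes "unimodular n U"
  obtains U' where "U' \<in> carrier_mat n n" "U' * U = 1\<^sub>m n" "U * U' = 1\<^sub>m n"
proof -
  from assms obtain c where U: "U \<in> carrier_mat n n" and c: "c \<noteq> 0" "det U = [:c:]"
    unfolding unimodular_def by blast
  let ?U' = "[:inverse c:] \<cdot>\<^sub>m adj_mat U"
  note adj = adj_mat[OF U]
  have "?U' \<in> carrier_mat n n" using adj by simp
  moreover have "?U' * U = 1\<^sub>m n"
    unfolding mult_smult_assoc_mat[OF adj(1) U] adj(3) c(2)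
    using c(1) by (intro eq_matI) (auto simp: one_pCons)
  moreover have "U * ?U' = 1\<^sub>m n"
    unfolding mult_smult_distrib[OF U adj(1)] adj(2) c(2)
    using c(1) by (intro eq_matI) (auto simp: one_pCons)
  ultimately show thesis by (rule that)
qed

lemma unimodularly_equivalent_mult_left:
  assumes "unimodularly_equivalent n P T" "unimodular n E"
  shows "unimodularly_equivalent n P (E * T)"
proof -
  from assms obtain U V where T: "P \<in> carrier_mat n n" "T = U * P * V" "unimodular n U" "unimodular n V"
    unfolding unimodularly_equivalent_def by blast
  have c: "U \<in> carrier_mat n n" "V \<in> carrier_mat n n" "E \<in> carrier_mat n n"
    using T assms by (auto simp: unimodular_def)
  have "E * T = E * U * P * V" using T(1) c
    by (simp add: T(2) assoc_mult_mat[of _ n n _ n _ n])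
  then show ?thesis using T c assms unimodular_mult[OF assms(2) T(3)]
    unfolding unimodularly_equivalent_def by (metis mult_carrier_mat)
qed

lemma unimodularly_equivalent_mult_right:
  assumes "unimodularly_equivalent n P T" "unimodular n E"
  shows "unimodularly_equivalent n P (T * E)"
proof -
  from assms obtain U V where T: "P \<in> carrier_mat n n" "T = U * P * V" "unimodular n U" "unimodular n V"
    unfolding unimodularly_equivalent_def by blast
  have c: "U \<in> carrier_mat n n" "V \<in> carrier_mat n n" "E \<in> carrier_mat n n"
    using T assms by (auto simp: unimodular_def)
  have "T * E = U * P * (V * E)" using T(1) c
    by (simp add: T(2) assoc_mult_mat[of _ n n _ n _ n])
  then show ?thesis using T c assms unimodular_mult[OF T(4) assms(2)]
    unfolding unimodularly_equivalent_def by (metis mult_carrier_mat)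
qed

lemma unimodularly_equivalent_addrow:
  assumes "unimodularly_equivalent n P T" "k \<noteq> l" "l < n"
  shows "unimodularly_equivalent n P (addrow q k l T)"
proof -
  have "T \<in> carrier_mat n n" using assms(1) by (simp add: unimodularly_equivalent_def)
  from addrow_mat[OF this assms(3)]
    unimodularly_equivalent_mult_left[OF assms(1) unimodular_addrow_mat[OF assms(2)]]
  show ?thesis by simp
qed

lemma unimodularly_equivalent_addcol:
  assumes "unimodularly_equivalent n P T" "k \<noteq> l" "l < n"
  shows "unimodularly_equivalent n P (addcol q k l T)"
proof -
  have "T \<in> carrier_mat n n" using assms(1) by (simp add: unimodularly_equivalent_def)
  from addcol_mat[OF this assms(3)] assms(2)
    unimodularly_equivalent_mult_right[OF assms(1) unimodular_addrow_mat[of l k]]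
  show ?thesis by simp
qed

text \<open>
  Two matrices equivalent to \<open>P\<close> are multiples of each other, which is all that a comparison of the
  divisors of their minors requires.
\<close>

lemma unimodularly_equivalent_factor:
  fixes P S T :: "'a::field poly mat"
  assumes "unimodularly_equivalent n P S" "unimodularly_equivalent n P T"
  obtains X Y where "X \<in> carrier_mat n n" "Y \<in> carrier_mat n n" "T = X * S * Y"
proof -
  from assms obtain U V where S: "P \<in> carrier_mat n n" "S = U * P * V" "unimodular n U" "unimodular n V"
    unfolding unimodularly_equivalent_def by blast
  from assms obtain U2 V2 where T: "T = U2 * P * V2" "unimodular n U2" "unimodular n V2"
    unfolding unimodularly_equivalent_def by blast
  obtain U' where U': "U' \<in> carrier_mat n n" "U' * U = 1\<^sub>m n"
    using unimodular_inverse[OF S(3)] by blast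
  obtain V' where V': "V' \<in> carrier_mat n n" "V * V' = 1\<^sub>m n"
    using unimodular_inverse[OF S(4)] by blast
  have c: "U \<in> carrier_mat n n" "V \<in> carrier_mat n n" "U2 \<in> carrier_mat n n" "V2 \<in> carrier_mat n n"
    using S T by (auto simp: unimodular_def)
  have "U' * S * V' = U' * (U * (P * (V * V')))" using c U'(1) V'(1) S(1)
    by (simp add: S(2) assoc_mult_mat[of _ n n _ n _ n])
  also have "\<dots> = (U' * U) * (P * (V * V'))" using c U'(1) V'(1) S(1)
    by (intro assoc_mult_mat[symmetric, of _ n n _ n _ n]) auto
  also have "\<dots> = P" using S(1) by (simp add: U' V')
  finally have P: "P = U' * S * V'" ..
  have "S \<in> carrier_mat n n" using c S(1,2) by auto
  then have "T = (U2 * U') * S * (V' * V2)"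
    using c U' V' S(1) by (simp add: T(1) P assoc_mult_mat[of _ n n _ n _ n])
  then show thesis using c U' V' by (intro that[of "U2 * U'" "V' * V2"]) auto
qed

lemma unimodularly_equivalent_det:
  fixes P T :: "'a::field poly mat"
  assumes "unimodularly_equivalent n P T"
  obtains c where "c \<noteq> 0" "det T = smult c (det P)"
proof -
  from assms obtain U V where T: "P \<in> carrier_mat n n" "T = U * P * V" "unimodular n U" "unimodular n V"
    unfolding unimodularly_equivalent_def by blast
  obtain b c where bc: "b \<noteq> 0" "det U = [:b:]" "c \<noteq> 0" "det V = [:c:]"
    using T unfolding unimodular_def by blast
  have c: "U \<in> carrier_mat n n" "V \<in> carrier_mat n n"
    using T by (auto simp: unimodular_def)
  have "det T = det U * det P * det V"
    using c T(1) by (simp add: T(2) det_mult[of _ n])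
  also have "\<dots> = smult (b * c) (det P)" using bc by (simp add: mult.commute)
  finally show thesis using bc by (intro that[of "b * c"]) auto
qed


section \<open>Irreducible factors of polynomials\<close>

lemma irreducible_factors_irreducible:
  "p \<noteq> 0 \<Longrightarrow> q \<in># irreducible_factors p \<Longrightarrow> irreducible q \<and> lead_coeff q = 1"
  using monic_factorization_irreducible_factors[of p] by (simp add: monic_factorization_def)

lemma smult_prod_irreducible_factors:
  "p \<noteq> 0 \<Longrightarrow> smult (lead_coeff p) (prod_mset (irreducible_factors p)) = p"
  using monic_factorization_irreducible_factors[of p] by (simp add: monic_factorization_def)

lemma irreducible_factors_mult:
  fixes p q :: "'a::field poly"
  assumes "p \<noteq> 0" "q \<noteq> 0"
  shows "irreducible_factors (p * q) = irreducible_factors p + irreducible_factors q"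
proof (rule irreducible_factors_eqI)
  have "smult (lead_coeff p * lead_coeff q)
      (prod_mset (irreducible_factors p) * prod_mset (irreducible_factors q)) =
      smult (lead_coeff p) (prod_mset (irreducible_factors p)) *
      smult (lead_coeff q) (prod_mset (irreducible_factors q))"
    by (simp add: mult.commute)
  also have "\<dots> = p * q"
    unfolding smult_prod_irreducible_factors[OF assms(1)] smult_prod_irreducible_factors[OF assms(2)] ..
  finally show "monic_factorization (p * q) (irreducible_factors p + irreducible_factors q)"
    using assms irreducible_factors_irreducible
    by (auto simp: monic_factorization_def lead_coeff_mult)
qed (use assms in simp)

lemma irreducible_factors_const: "c \<noteq> 0 \<Longrightarrow> irreducible_factors [:c:] = {#}"
  by (rule irreducible_factors_eqI) (auto simp: monic_factorization_def)

lemma irreducible_factors_one: "irreducible_factors 1 = {#}"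
  using irreducible_factors_const[of 1] by (simp add: one_pCons)

lemma irreducible_factors_smult:
  "c \<noteq> 0 \<Longrightarrow> p \<noteq> 0 \<Longrightarrow> irreducible_factors (smult c p) = irreducible_factors p"
  using irreducible_factors_mult[of "[:c:]" p] by (simp add: irreducible_factors_const)

lemma irreducible_factors_monic_irreducible:
  "irreducible p \<Longrightarrow> lead_coeff p = 1 \<Longrightarrow> irreducible_factors p = {#p#}"
  by (rule irreducible_factors_eqI) (auto simp: monic_factorization_def)

lemma irreducible_factors_prod:
  assumes "finite A" "\<And>i. i \<in> A \<Longrightarrow> f i \<noteq> 0"
  shows "irreducible_factors (prod f A) = (\<Sum>i\<in>A. irreducible_factors (f i))"
  using assms
proof (induction A rule: finite_induct)
  case (insert x F)
  then have "prod f F \<noteq> 0" by auto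
  with insert show ?case by (simp add: irreducible_factors_mult)
qed (simp add: irreducible_factors_one)

lemma dvd_iff_irreducible_factors:
  fixes p q :: "'a::field poly"
  assumes "p \<noteq> 0" "q \<noteq> 0"
  shows "p dvd q \<longleftrightarrow> irreducible_factors p \<subseteq># irreducible_factors q"
proof
  assume "p dvd q"
  then obtain r where "q = p * r" by (rule dvdE)
  with assms show "irreducible_factors p \<subseteq># irreducible_factors q"
    by (auto simp: irreducible_factors_mult)
next
  assume "irreducible_factors p \<subseteq># irreducible_factors q"
  then have "prod_mset (irreducible_factors p) dvd prod_mset (irreducible_factors q)"
    by (rule prod_mset_subset_imp_dvd)
  then have "smult (lead_coeff p) (prod_mset (irreducible_factors p)) dvd
      smult (lead_coeff q) (prod_mset (irreducible_factors q))"
    using assms by (simp add: smult_dvd_iff dvd_smult)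
  then show "p dvd q"
    unfolding smult_prod_irreducible_factors[OF assms(1)] smult_prod_irreducible_factors[OF assms(2)] .
qed

lemma irreducible_factors_dvd: "p \<noteq> 0 \<Longrightarrow> q \<in># irreducible_factors p \<Longrightarrow> q dvd p"
  using irreducible_factors_irreducible[of p q]
  by (subst dvd_iff_irreducible_factors) (auto simp: irreducible_factors_monic_irreducible)

lemma factors_of_degree_mult:
  "p \<noteq> 0 \<Longrightarrow> q \<noteq> 0 \<Longrightarrow> factors_of_degree m (p * q) = factors_of_degree m p + factors_of_degree m q"
  by (simp add: factors_of_degree_def irreducible_factors_mult)

lemma factors_of_degree_prod:
  fixes f :: "'b \<Rightarrow> 'a::field poly"
  assumes "finite A" "\<And>i. i \<in> A \<Longrightarrow> f i \<noteq> 0"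
  shows "factors_of_degree m (prod f A) = (\<Sum>i\<in>A. factors_of_degree m (f i))"
proof -
  have "filter_mset P (\<Sum>i\<in>A. g i) = (\<Sum>i\<in>A. filter_mset P (g i))"
    for P and g :: "'b \<Rightarrow> 'a poly multiset"
    by (induction A rule: infinite_finite_induct) auto
  then show ?thesis using assms by (simp add: factors_of_degree_def irreducible_factors_prod)
qed

lemma size_factors_of_degree_prod:
  fixes f :: "'b \<Rightarrow> 'a::field poly"
  assumes "finite A" "\<And>i. i \<in> A \<Longrightarrow> f i \<noteq> 0"
  shows "size (factors_of_degree m (prod f A)) = (\<Sum>i\<in>A. size (factors_of_degree m (f i)))"
  using assms by (simp add: factors_of_degree_prod size_multiset_sum)

lemma factors_of_degree_mono:
  assumes "p dvd q" "p \<noteq> 0" "q \<noteq> 0"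
  shows "factors_of_degree m p \<subseteq># factors_of_degree m q"
  using assms by (simp add: factors_of_degree_def dvd_iff_irreducible_factors multiset_filter_mono)

lemma degree_eq_sum_irreducible_factors:
  fixes p :: "'a::field poly"
  assumes "p \<noteq> 0"
  shows "degree p = (\<Sum>q\<in>#irreducible_factors p. degree q)"
proof -
  have "degree (prod_mset A) = (\<Sum>q\<in>#A. degree q)" if "0 \<notin># A" for A :: "'a poly multiset"
    using that by (induction A) (auto simp: degree_mult_eq prod_mset_zero_iff)
  moreover have "0 \<notin># irreducible_factors p"
    using irreducible_factors_irreducible[OF assms, of 0] by auto
  moreover have "degree p = degree (prod_mset (irreducible_factors p))"
    using assms smult_prod_irreducible_factors[OF assms] by (metis degree_smult_eq leading_coeff_0_iff)
  ultimately show ?thesis by simp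
qed

lemma degree_eq_factor_counts:
  fixes p :: "'a::field poly"
  assumes "p \<noteq> 0" "m \<noteq> k" "\<And>q. q \<in># irreducible_factors p \<Longrightarrow> degree q = m \<or> degree q = k"
  shows "degree p = m * size (factors_of_degree m p) + k * size (factors_of_degree k p)"
proof -
  have "(\<Sum>q\<in>#A. degree q) = m * size {#q \<in># A. degree q = m#} + k * size {#q \<in># A. degree q = k#}"
    if "\<And>q. q \<in># A \<Longrightarrow> degree q = m \<or> degree q = k" for A :: "'a poly multiset"
    using that
  proof (induction A)
    case (add x A)
    then show ?case using assms(2) by (cases "degree x = m") force+
  qed simp
  then show ?thesis using assms degree_eq_sum_irreducible_factors[OF assms(1)]
    by (simp add: factors_of_degree_def)
qed

text \<open>
  If \<open>a\<close> has more irreducible factors of degree \<open>m\<close> than \<open>b\<close>, then some single \<open>p\<close> of degree \<open>m\<close> occurs in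
  \<open>a\<close> with larger multiplicity than in \<open>b\<close>. A common divisor of \<open>a\<close> and \<open>b\<close> contains \<open>p\<close> at most as
  often as \<open>b\<close> does, so it still divides \<open>a\<close> after \<open>p\<close> is removed. The last conclusion is the one under which a
  pair of diagonal entries may be replaced by another pair.
\<close>

lemma transfer_irreducible_factor:
  fixes a b :: "'a::field poly"
  assumes nz: "a \<noteq> 0" "b \<noteq> 0"
    and more: "size (factors_of_degree m b) < size (factors_of_degree m a)"
  obtains a' p where "a = p * a'" "irreducible p" "lead_coeff p = 1" "degree p = m"
    "\<And>\<delta>. \<delta> dvd a \<Longrightarrow> \<delta> dvd b \<Longrightarrow> \<delta> dvd a' \<and> \<delta> dvd p * b"
proof -
  let ?F = "irreducible_factors :: 'a poly \<Rightarrow> _"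
  have "\<not> factors_of_degree m a \<subseteq># factors_of_degree m b"
    using more size_mset_mono by (metis leD)
  then obtain p where p: "count (factors_of_degree m b) p < count (factors_of_degree m a) p"
    by (meson leI subseteq_mset_def)
  then have "p \<in># factors_of_degree m a" by (metis count_greater_zero_iff le_less_trans zero_le)
  then have pF: "p \<in># ?F a" and deg: "degree p = m" by (auto simp: factors_of_degree_def)
  have irr: "irreducible p" "lead_coeff p = 1" using irreducible_factors_irreducible[OF nz(1) pF] by auto
  have count: "count (?F b) p < count (?F a) p" using p deg by (simp add: factors_of_degree_def)
  obtain a' where a': "a = p * a'" using irreducible_factors_dvd[OF nz(1) pF] by (rule dvdE)
  have nz': "p \<noteq> 0" "a' \<noteq> 0" using nz a' by auto
  have Fa: "?F a = add_mset p (?F a')"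
    using nz' irr by (simp add: a' irreducible_factors_mult irreducible_factors_monic_irreducible)
  have "\<delta> dvd a' \<and> \<delta> dvd p * b" if "\<delta> dvd a" "\<delta> dvd b" for \<delta>
  proof
    have d0: "\<delta> \<noteq> 0" using that nz by auto
    have sub: "?F \<delta> \<subseteq># ?F a" "?F \<delta> \<subseteq># ?F b" using that d0 nz by (auto simp: dvd_iff_irreducible_factors)
    have "count (?F \<delta>) q \<le> count (?F a') q" for q
      using mset_subset_eq_count[OF sub(1), of q] mset_subset_eq_count[OF sub(2), of q] count Fa
      by (auto split: if_splits)
    then show "\<delta> dvd a'" using d0 nz' by (simp add: dvd_iff_irreducible_factors subseteq_mset_def)
  qed (use that in simp)
  with a' irr deg that show thesis by blast
qed


section \<open>Unit transfers and majorization\<close>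

lemma unit_transfer_sums:
  fixes u :: "nat \<Rightarrow> int"
  assumes "i < j"
  shows "(\<Sum>k<l. (u(i := u i + 1, j := u j - 1)) k) =
    (\<Sum>k<l. u k) + (if i < l \<and> l \<le> j then 1 else 0)"
proof (induction l)
  case (Suc l)
  then show ?case using assms by (auto simp: less_Suc_eq)
qed simp

text \<open>
  The discrete form of Muirhead's lemma: \<open>u\<close> can be turned into the nondecreasing vector \<open>v\<close> by moving
  units from larger entries to smaller ones as soon as no prefix sum of \<open>u\<close> exceeds that of \<open>v\<close>.
  Let \<open>i\<close> be the first index with \<open>u i \<noteq> v i\<close>, so \<open>u i < v i\<close>, and \<open>j\<close> the first later index after
  which the prefix sums agree again. Then \<open>u j > v j \<ge> v i > u i\<close>, and all prefix sums between the two
  have room for one more unit, so a unit may move from \<open>j\<close> to \<open>i\<close>. Each such move shrinks the total gap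
  between the prefix sums.
\<close>

lemma unit_transfers_reach_nondecreasing:
  fixes u v :: "nat \<Rightarrow> int"
  assumes step: "\<And>u i j. \<lbrakk>A u; i < n; j < n; u i < u j\<rbrakk> \<Longrightarrow> A (u(i := u i + 1, j := u j - 1))"
    and start: "A u"
    and mono: "\<And>i j. i \<le> j \<Longrightarrow> j < n \<Longrightarrow> v i \<le> v j"
    and dom: "\<And>l. l \<le> n \<Longrightarrow> (\<Sum>i<l. u i) \<le> (\<Sum>i<l. v i)"
    and total: "(\<Sum>i<n. u i) = (\<Sum>i<n. v i)"
  obtains w where "A w" "\<And>i. i < n \<Longrightarrow> w i = v i"
proof -
  define gap where "gap u l = (\<Sum>i<l. v i) - (\<Sum>i<l. u i)" for u :: "nat \<Rightarrow> int" and l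
  have "\<exists>w. A w \<and> (\<forall>i<n. w i = v i)" if "A u" "\<forall>l\<le>n. 0 \<le> gap u l" "gap u n = 0" for u
    using that
  proof (induction "nat (\<Sum>l\<le>n. gap u l)" arbitrary: u rule: less_induct)
    case less
    show ?case
    proof (cases "\<forall>i<n. u i = v i")
      case False
      define i where "i = (LEAST i. i < n \<and> u i \<noteq> v i)"
      have i: "i < n" "u i \<noteq> v i" using False LeastI_ex[of "\<lambda>i. i < n \<and> u i \<noteq> v i"]
        by (auto simp: i_def)
      have eq: "u l = v l" if "l < i" for l
        using not_less_Least[of l "\<lambda>i. i < n \<and> u i \<noteq> v i"] that i by (auto simp: i_def[symmetric])
      then have gi: "gap u i = 0" by (simp add: gap_def)
      have gSuc: "gap u (Suc l) = gap u l + (v l - u l)" for l by (simp add: gap_def)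
      have "u i < v i" using less.prems(2) gSuc[of i] gi i by (auto dest: spec[of _ "Suc i"])
      define j where "j = (LEAST j. i < j \<and> gap u (Suc j) = 0)"
      have "i \<noteq> n - 1"
      proof
        assume "i = n - 1"
        then have "Suc i = n" using i by simp
        then show False using gSuc[of i] gi \<open>u i < v i\<close> less.prems(3) by simp
      qed
      then have ex: "i < n - 1 \<and> gap u (Suc (n - 1)) = 0" using i less.prems(3) by auto
      have j: "i < j" "gap u (Suc j) = 0" "j \<le> n - 1"
        using LeastI[of "\<lambda>j. i < j \<and> gap u (Suc j) = 0", OF ex]
          Least_le[of "\<lambda>j. i < j \<and> gap u (Suc j) = 0", OF ex] by (auto simp: j_def)
      then have jn: "j < n" using i by simp
      have pos: "0 < gap u l" if l: "i < l" "l \<le> j" for l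
      proof -
        obtain m where m: "l = Suc m" using l by (cases l) auto
        have "gap u l \<noteq> 0"
        proof (cases "m = i")
          case True
          then show ?thesis using gSuc[of i] gi \<open>u i < v i\<close> m by simp
        next
          case False
          with l m have "i < m" "m < j" by auto
          with not_less_Least[of m "\<lambda>j. i < j \<and> gap u (Suc j) = 0"] show ?thesis
            unfolding j_def[symmetric] m by auto
        qed
        moreover have "0 \<le> gap u l" using less.prems(2) l jn by simp
        ultimately show ?thesis by simp
      qed
      have "v j < u j" using gSuc[of j] pos[of j] j by simp
      with mono[of i j] j jn \<open>u i < v i\<close> have uij: "u i < u j" by simp
      let ?u = "u(i := u i + 1, j := u j - 1)"
      have gap': "gap ?u l = gap u l - (if i < l \<and> l \<le> j then 1 else 0)" for l
        unfolding gap_def unit_transfer_sums[OF j(1)] by simp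
      have "(\<Sum>l\<le>n. gap ?u l) < (\<Sum>l\<le>n. gap u l)"
      proof (rule sum_strict_mono_ex1)
        show "\<exists>l\<in>{..n}. gap ?u l < gap u l" using j jn by (intro bexI[of _ j]) (auto simp: gap')
      qed (auto simp: gap')
      moreover have "0 \<le> gap ?u l" if "l \<le> n" for l
        using less.prems(2) that pos[of l] by (auto simp: gap')
      moreover from this have "0 \<le> (\<Sum>l\<le>n. gap ?u l)" by (intro sum_nonneg) auto
      moreover have "gap ?u n = 0" using less.prems(3) jn by (simp add: gap')
      moreover have "A ?u" using step[OF less.prems(1) _ jn uij] i by simp
      ultimately show ?thesis by (intro less.hyps) auto
    qed (use less.prems in blast)
  qed
  from this[OF start] dom total that show thesis by (auto simp: gap_def)
qed

text \<open>
  A vector whose entries differ by at most 1 is minimal for majorization, so every vector with the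
  same sum reaches it: if \<open>u i < v i\<close> and \<open>u j > v j\<close>, then
  \<open>u i < u j\<close> because \<open>v i \<le> v j + 1\<close>.
\<close>

lemma unit_transfers_reach_homogeneous:
  fixes u v :: "nat \<Rightarrow> int"
  assumes step: "\<And>u i j. \<lbrakk>A u; i < n; j < n; u i < u j\<rbrakk> \<Longrightarrow> A (u(i := u i + 1, j := u j - 1))"
    and start: "A u"
    and homogeneous: "\<And>i j. i < n \<Longrightarrow> j < n \<Longrightarrow> v i \<le> v j + 1"
    and total: "(\<Sum>i<n. u i) = (\<Sum>i<n. v i)"
  obtains w where "A w" "\<And>i. i < n \<Longrightarrow> w i = v i"
proof -
  have "\<exists>w. A w \<and> (\<forall>i<n. w i = v i)" if "A u" "(\<Sum>i<n. u i) = (\<Sum>i<n. v i)" for u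
    using that
  proof (induction "nat (\<Sum>i<n. \<bar>u i - v i\<bar>)" arbitrary: u rule: less_induct)
    case less
    show ?case
    proof (cases "\<forall>i<n. u i = v i")
      case False
      have "\<exists>i<n. u i < v i"
      proof (rule ccontr)
        assume *: "\<not> (\<exists>i<n. u i < v i)"
        with False have "(\<Sum>i<n. v i) < (\<Sum>i<n. u i)"
          by (intro sum_strict_mono_ex1) force+
        with less.prems show False by simp
      qed
      then obtain i where i: "i < n" "u i < v i" by blast
      have "\<exists>j<n. v j < u j"
      proof (rule ccontr)
        assume *: "\<not> (\<exists>j<n. v j < u j)"
        with False have "(\<Sum>i<n. u i) < (\<Sum>i<n. v i)"
          by (intro sum_strict_mono_ex1) force+
        with less.prems show False by simp
      qed
      then obtain j where j: "j < n" "v j < u j" by blast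
      have uij: "u i < u j" using homogeneous[OF i(1) j(1)] i j by simp
      have ij: "i \<noteq> j" using i j by auto
      let ?u = "u(i := u i + 1, j := u j - 1)"
      have "(\<Sum>l<n. \<bar>?u l - v l\<bar>) < (\<Sum>l<n. \<bar>u l - v l\<bar>)"
      proof (rule sum_strict_mono_ex1)
        show "\<exists>l\<in>{..<n}. \<bar>?u l - v l\<bar> < \<bar>u l - v l\<bar>"
          using i ij by (intro bexI[of _ i]) auto
      qed (use i j in auto)
      moreover from this have "0 < (\<Sum>l<n. \<bar>u l - v l\<bar>)"
        by (rule le_less_trans[rotated]) (intro sum_nonneg, simp)
      moreover have "(\<Sum>l<n. ?u l) = (\<Sum>l<n. u l)"
      proof -
        have "(\<Sum>l<n. ?u l) = (\<Sum>l<n. u l + ((if l = i then 1 else 0) - (if l = j then 1 else 0)))"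
          using ij by (intro sum.cong) auto
        also have "\<dots> = (\<Sum>l<n. u l)" using i j by (simp add: sum.distrib sum_subtractf)
        finally show ?thesis .
      qed
      moreover have "A ?u" using step[OF less.prems(1) i(1) j(1) uij] .
      ultimately show ?thesis using less.prems(2)
        by (intro less.hyps[of ?u]) (simp_all del: fun_upd_apply)
    qed (use less.prems in blast)
  qed
  from this[OF start total] that show thesis by blast
qed

lemma exists_top_subset:
  fixes e :: "nat \<Rightarrow> int"
  assumes "l \<le> n"
  shows "\<exists>I \<subseteq> {..<n}. card I = l \<and> (\<forall>i\<in>I. \<forall>j\<in>{..<n} - I. e j \<le> e i)"
  using assms
proof (induction l)
  case (Suc l)
  then obtain I where I: "I \<subseteq> {..<n}" "card I = l" "\<forall>i\<in>I. \<forall>j\<in>{..<n} - I. e j \<le> e i" by auto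
  have fin: "finite I" using I(1) finite_subset by blast
  have "card ({..<n} - I) = n - l" using I by (simp add: card_Diff_subset fin)
  with Suc.prems have "{..<n} - I \<noteq> {}" by (metis card.empty diff_is_0_eq not_less_eq_eq)
  then have "Max (e ` ({..<n} - I)) \<in> e ` ({..<n} - I)" by (intro Max_in) auto
  then obtain m where m: "m \<in> {..<n} - I" "e m = Max (e ` ({..<n} - I))" by auto
  have "e j \<le> e m" if "j \<in> {..<n} - I" for j using that unfolding m(2) by (intro Max_ge) auto
  then show ?case using I m fin by (intro exI[of _ "insert m I"]) auto
qed auto

text \<open>
  The converse side of the same minimality: the \<open>l\<close> largest entries of \<open>e\<close> sum to at least as much as
  the first \<open>l\<close> entries of \<open>v\<close>. With \<open>\<mu>\<close> the minimum of \<open>v\<close>, either all of these largest entries are at least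
  \<open>\<mu> + 1\<close>, an upper bound for \<open>v\<close>, or all remaining entries of \<open>e\<close> are at most \<open>\<mu>\<close>, a lower bound
  for \<open>v\<close>, and the complementary sums can be compared instead.
\<close>

lemma homogeneous_prefix_le_top_sum:
  fixes e v :: "nat \<Rightarrow> int"
  assumes homogeneous: "\<And>i j. i < n \<Longrightarrow> j < n \<Longrightarrow> v i \<le> v j + 1"
    and total: "(\<Sum>i<n. e i) = (\<Sum>i<n. v i)" and l: "l \<le> n"
  obtains I where "I \<subseteq> {..<n}" "card I = l" "(\<Sum>i<l. v i) \<le> (\<Sum>i\<in>I. e i)"
proof -
  obtain I where I: "I \<subseteq> {..<n}" "card I = l" and top: "\<forall>i\<in>I. \<forall>j\<in>{..<n} - I. e j \<le> e i"
    using exists_top_subset[OF l] by blast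
  have fin: "finite I" using I(1) finite_subset by blast
  have "(\<Sum>i<l. v i) \<le> (\<Sum>i\<in>I. e i)"
  proof (cases "n = 0")
    case False
    define \<mu> where "\<mu> = Min (v ` {..<n})"
    have low: "\<mu> \<le> v i" if "i < n" for i using that unfolding \<mu>_def by (intro Min_le) auto
    have "\<mu> \<in> v ` {..<n}" using False unfolding \<mu>_def by (intro Min_in) auto
    then have high: "v i \<le> \<mu> + 1" if "i < n" for i using homogeneous that by auto
    show ?thesis
    proof (cases "\<forall>i\<in>I. \<mu> + 1 \<le> e i")
      case True
      have "(\<Sum>i<l. v i) \<le> (\<Sum>i<l. \<mu> + 1)" using high l by (intro sum_mono) auto
      also have "\<dots> = (\<Sum>i\<in>I. \<mu> + 1)" using I by simp
      also have "\<dots> \<le> (\<Sum>i\<in>I. e i)" using True by (intro sum_mono) auto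
      finally show ?thesis .
    next
      case False
      then obtain i where i: "i \<in> I" "e i \<le> \<mu>" by force
      have "(\<Sum>j\<in>{..<n} - I. e j) \<le> (\<Sum>j\<in>{..<n} - I. \<mu>)"
        using top i by (intro sum_mono) force
      also have "\<dots> = (\<Sum>j\<in>{l..<n}. \<mu>)" using I l by (simp add: card_Diff_subset fin)
      also have "\<dots> \<le> (\<Sum>j\<in>{l..<n}. v j)" using low by (intro sum_mono) auto
      finally have "(\<Sum>j\<in>{..<n} - I. e j) \<le> (\<Sum>j\<in>{l..<n}. v j)" .
      moreover have "(\<Sum>i<n. e i) = (\<Sum>j\<in>{..<n} - I. e j) + (\<Sum>i\<in>I. e i)"
        using I(1) by (intro sum.subset_diff) auto
      moreover have "(\<Sum>i<n. v i) = (\<Sum>i<l. v i) + (\<Sum>j\<in>{l..<n}. v j)"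
        using l by (simp add: sum.atLeastLessThan_concat lessThan_atLeast0)
      ultimately show ?thesis using total by simp
    qed
  qed (use l I in auto)
  with I that show thesis by blast
qed

lemma sum_list_take: "l \<le> length xs \<Longrightarrow> sum_list (take l xs) = (\<Sum>i<l. xs ! i)"
  by (simp add: sum_list_sum_nth lessThan_atLeast0)

text \<open>
  For nondecreasing lists the \<open>l\<close> largest entries form a suffix, and with equal totals a comparison of
  suffix sums is the reverse comparison of prefix sums.
\<close>

lemma majorizes_sorted_iff:
  fixes xs ys :: "int list"
  assumes "sorted xs" "sorted ys" "length xs = n" "length ys = n"
  shows "majorizes xs ys \<longleftrightarrow> (\<Sum>i<n. xs ! i) = (\<Sum>i<n. ys ! i) \<and>
    (\<forall>l\<le>n. (\<Sum>i<l. xs ! i) \<le> (\<Sum>i<l. ys ! i))"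
proof -
  have top: "sum_list (take l (nonincreasing zs)) = sum_list zs - (\<Sum>i<n-l. zs ! i)"
    if "sorted zs" "length zs = n" "l \<le> n" for zs :: "int list" and l
  proof -
    have "sum_list (take l (nonincreasing zs)) = sum_list (drop (n - l) zs)"
      using that by (simp add: nonincreasing_def sorted_sort_id take_rev sum_list_rev)
    moreover have "sum_list zs = sum_list (take (n - l) zs) + sum_list (drop (n - l) zs)"
      by (metis append_take_drop_id sum_list_append)
    ultimately show ?thesis using that sum_list_take[of "n - l" zs] by simp
  qed
  have sums: "sum_list xs = (\<Sum>i<n. xs ! i)" "sum_list ys = (\<Sum>i<n. ys ! i)"
    using assms by (auto simp: sum_list_sum_nth lessThan_atLeast0)
  show ?thesis
  proof (cases "sum_list xs = sum_list ys")
    case True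
    have "majorizes xs ys \<longleftrightarrow> (\<forall>l\<in>{1..n}. (\<Sum>i<n-l. xs ! i) \<le> (\<Sum>i<n-l. ys ! i))"
      using True assms by (auto simp: majorizes_def top)
    also have "\<dots> \<longleftrightarrow> (\<forall>l\<le>n. (\<Sum>i<l. xs ! i) \<le> (\<Sum>i<l. ys ! i))"
    proof (intro iffI allI impI ballI)
      fix l assume *: "\<forall>l\<in>{1..n}. (\<Sum>i<n-l. xs ! i) \<le> (\<Sum>i<n-l. ys ! i)" "l \<le> n"
      show "(\<Sum>i<l. xs ! i) \<le> (\<Sum>i<l. ys ! i)"
      proof (cases "l = n")
        case False
        then show ?thesis using *(1)[rule_format, of "n - l"] *(2) by auto
      qed (use True sums in simp)
    qed auto
    finally show ?thesis using True sums by simp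
  qed (use sums in \<open>auto simp: majorizes_def\<close>)
qed


section \<open>Changing the diagonal of a triangular matrix\<close>

text \<open>
  A \<open>2 \<times> 2\<close> matrix is determined up to equivalence by its determinant and by the greatest common
  divisor \<open>w\<close> of its entries. Hence an upper triangular block with diagonal \<open>a, b\<close> is equivalent to
  one with diagonal \<open>a', b'\<close> and \<open>w\<close> in the corner, provided that \<open>a' b' = a b\<close> and that \<open>w\<close> divides
  \<open>a'\<close> and \<open>b'\<close>; the latter holds if every common divisor of \<open>a\<close> and \<open>b\<close> divides \<open>a'\<close> and \<open>b'\<close>.
  The predicate \<open>Q w x y z\<close> stands for reachability of the block with rows \<open>(w, x)\<close> and \<open>(y, z)\<close>. It is
  abstract so that the block may sit inside a larger matrix. Only the addition of a multiple of a row
  or column to the other one is used, so that the determinant is kept exactly, without a sign.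
\<close>

lemma reshape_two_by_two_block:
  fixes Q :: "'a::field poly \<Rightarrow> 'a poly \<Rightarrow> 'a poly \<Rightarrow> 'a poly \<Rightarrow> bool"
  assumes row1: "\<And>r w x y z. Q w x y z \<Longrightarrow> Q (r * y + w) (r * z + x) y z"
    and row2: "\<And>r w x y z. Q w x y z \<Longrightarrow> Q w x (r * w + y) (r * x + z)"
    and col1: "\<And>r w x y z. Q w x y z \<Longrightarrow> Q (r * x + w) x (r * z + y) z"
    and col2: "\<And>r w x y z. Q w x y z \<Longrightarrow> Q w (r * w + x) y (r * y + z)"
    and start: "Q a x 0 b" and a0: "a \<noteq> 0"
    and prod: "a' * b' = a * b"
    and common: "\<And>\<delta>. \<delta> dvd a \<Longrightarrow> \<delta> dvd b \<Longrightarrow> \<delta> dvd a' \<and> \<delta> dvd b'"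
  obtains x' where "Q a' x' 0 b'"
proof -
  \<comment> \<open>The reachable blocks of determinant \<open>a b\<close>. All of them have the same common divisors of their
    four entries as the initial block, so such a divisor divides \<open>a\<close> and \<open>b\<close>.\<close>
  define R where "R w x y z \<longleftrightarrow> Q w x y z \<and> w * z - x * y = a * b \<and>
    (\<forall>\<delta>. \<delta> dvd w \<longrightarrow> \<delta> dvd x \<longrightarrow> \<delta> dvd y \<longrightarrow> \<delta> dvd z \<longrightarrow> \<delta> dvd a \<and> \<delta> dvd b)" for w x y z
  have cancel: "\<delta> dvd r * u + v \<Longrightarrow> \<delta> dvd u \<Longrightarrow> \<delta> dvd v" for \<delta> r u v :: "'a poly"
    by (metis dvd_add_right_iff dvd_mult)
  have RI: "R w' x' y' z'"
    if "R w x y z" "Q w' x' y' z'" "w' * z' - x' * y' = w * z - x * y"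
      "\<And>\<delta>. \<lbrakk>\<delta> dvd w'; \<delta> dvd x'; \<delta> dvd y'; \<delta> dvd z'\<rbrakk> \<Longrightarrow> \<delta> dvd w \<and> \<delta> dvd x \<and> \<delta> dvd y \<and> \<delta> dvd z"
    for w x y z w' x' y' z'
    using that unfolding R_def by auto
  have R1: "R (r * y + w) (r * z + x) y z" if R: "R w x y z" for r w x y z
  proof (rule RI[OF R])
    show "Q (r * y + w) (r * z + x) y z" using R row1 by (simp add: R_def)
  qed (simp add: algebra_simps, blast dest: cancel)
  have R2: "R w x (r * w + y) (r * x + z)" if R: "R w x y z" for r w x y z
  proof (rule RI[OF R])
    show "Q w x (r * w + y) (r * x + z)" using R row2 by (simp add: R_def)
  qed (simp add: algebra_simps, blast dest: cancel)
  have C1: "R (r * x + w) x (r * z + y) z" if R: "R w x y z" for r w x y z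
  proof (rule RI[OF R])
    show "Q (r * x + w) x (r * z + y) z" using R col1 by (simp add: R_def)
  qed (simp add: algebra_simps, blast dest: cancel)
  have C2: "R w (r * w + x) y (r * y + z)" if R: "R w x y z" for r w x y z
  proof (rule RI[OF R])
    show "Q w (r * w + x) y (r * y + z)" using R col2 by (simp add: R_def)
  qed (simp add: algebra_simps, blast dest: cancel)
  \<comment> \<open>Three additions amount to exchanging the rows, up to the sign that keeps the determinant.\<close>
  have rot_row: "R y z (- w) (- x)" if "R w x y z" for w x y z
    using R1[OF R2[OF R1[OF that, of 1], of "-1"], of 1] by simp
  have rot_col: "R x (- w) z (- y)" if "R w x y z" for w x y z
    using C1[OF C2[OF C1[OF that, of 1], of "-1"], of 1] by simp
  \<comment> \<open>An entry of least degree among all reachable blocks divides its neighbours, since otherwise a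
    remainder could be moved to its place. It ends up as the greatest common divisor.\<close>
  have "R a x 0 b" using start by (simp add: R_def)
  with a0 have "\<exists>w. w \<noteq> 0 \<and> (\<exists>x y z. R w x y z)" by blast
  then obtain w where w: "w \<noteq> 0" "\<exists>x y z. R w x y z"
    and least: "\<And>w'. w' \<noteq> 0 \<and> (\<exists>x y z. R w' x y z) \<Longrightarrow> degree w \<le> degree w'"
    using ex_has_least_nat[of "\<lambda>w. w \<noteq> 0 \<and> (\<exists>x y z. R w x y z)" _ degree] by blast
  have zero: "v = 0" if "R v x y z" "v = 0 \<or> degree v < degree w" for v x y z
    using least[of v] that by force
  have split: "- (u div w) * w + u = u mod w" for u
    by (simp add: minus_div_mult_eq_mod [symmetric])
  have rem: "u mod w = 0 \<or> degree (u mod w) < degree w" for u using degree_mod_less[OF w(1)] .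
  have dx: "w dvd x" if "R w x y z" for x y z
  proof -
    from rot_col[OF C2[OF that, of "- (x div w)"]] have "x mod w = 0"
      unfolding split by (rule zero[OF _ rem])
    then show ?thesis by (simp add: dvd_eq_mod_eq_0)
  qed
  have dy: "w dvd y" if "R w x y z" for x y z
  proof -
    from rot_row[OF R2[OF that, of "- (y div w)"]] have "y mod w = 0"
      unfolding split by (rule zero[OF _ rem])
    then show ?thesis by (simp add: dvd_eq_mod_eq_0)
  qed
  from w obtain x y z where "R w x y z" by blast
  from C2[OF this, of "- (x div w)"] dx[OF this]
  have "R w 0 y (- (x div w) * y + z)" unfolding split by (simp add: dvd_eq_mod_eq_0)
  then obtain z1 where z1: "R w 0 y z1" by blast
  from R2[OF this, of "- (y div w)"] dy[OF this]
  have z: "R w 0 0 z1" unfolding split by (simp add: dvd_eq_mod_eq_0)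
  \<comment> \<open>Adding the second row to the first one makes \<open>z1\<close> a neighbour of \<open>w\<close>.\<close>
  from R1[OF this, of 1] have "w dvd z1" using dx[of z1 0 z1] by simp
  with z have "w dvd a" "w dvd b" by (auto simp: R_def)
  with common obtain \<alpha> \<beta> where ab: "a' = w * \<alpha>" "b' = w * \<beta>" by (meson dvd_def)
  have "w * z1 = w * (w * \<alpha> * \<beta>)" using z prod by (simp add: R_def ab algebra_simps)
  with w(1) have z1: "z1 = w * \<alpha> * \<beta>" by simp
  from R2[OF C1[OF rot_col[OF z], of "- \<alpha>"], of "- \<beta>"]
  have "R a' (- w) 0 b'" by (simp add: ab z1 algebra_simps)
  then show thesis by (intro that[of "- w"]) (simp add: R_def)
qed

text \<open>
  No degree bound is imposed on the entries above the diagonal. They are reduced only once the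
  diagonal is final.
\<close>

definition has_triangular_diagonal :: "nat \<Rightarrow> 'a::field poly mat \<Rightarrow> 'a poly list \<Rightarrow> bool" where
  "has_triangular_diagonal n P ts \<longleftrightarrow>
     (\<exists>T. unimodularly_equivalent n P T \<and> upper_triangular T \<and> diag_mat T = ts)"

text \<open>
  Row and column operations between positions \<open>i\<close> and \<open>i + 1\<close> disturb upper triangularity at the single
  entry \<open>(i + 1, i)\<close> and leave the other diagonal entries alone, so the \<open>2 \<times> 2\<close> statement applies to two
  neighbouring diagonal entries of a triangular matrix.
\<close>

lemma has_triangular_diagonal_adjacent:
  fixes P :: "'a::field poly mat"
  assumes R: "has_triangular_diagonal n P (ys @ a # b # zs)" and a0: "a \<noteq> 0"
    and prod: "a' * b' = a * b"
    and common: "\<And>\<delta>. \<delta> dvd a \<Longrightarrow> \<delta> dvd b \<Longrightarrow> \<delta> dvd a' \<and> \<delta> dvd b'"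
  shows "has_triangular_diagonal n P (ys @ a' # b' # zs)"
proof -
  define ts i where "ts = ys @ a # b # zs" and "i = length ys"
  \<comment> \<open>Reachability of the block at positions \<open>i\<close> and \<open>i + 1\<close>, with the entry below the diagonal free.\<close>
  define Q where "Q w x y z \<longleftrightarrow> (\<exists>T. unimodularly_equivalent n P T \<and>
    (\<forall>r c. r < n \<longrightarrow> c < r \<longrightarrow> \<not> (r = Suc i \<and> c = i) \<longrightarrow> T $$ (r, c) = 0) \<and>
    (\<forall>r<n. r \<noteq> i \<longrightarrow> r \<noteq> Suc i \<longrightarrow> T $$ (r, r) = ts ! r) \<and>
    T $$ (i, i) = w \<and> T $$ (i, Suc i) = x \<and> T $$ (Suc i, i) = y \<and> T $$ (Suc i, Suc i) = z)"
    for w x y z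
  from R obtain T where T: "unimodularly_equivalent n P T" "upper_triangular T" "diag_mat T = ts"
    unfolding has_triangular_diagonal_def ts_def by blast
  have Tc: "T \<in> carrier_mat n n" using T(1) by (simp add: unimodularly_equivalent_def)
  have len: "length ts = n" using T(3) Tc by (auto simp: diag_mat_def)
  have nth: "ts ! r = T $$ (r, r)" if "r < n" for r using T(3) Tc that by (auto simp: diag_mat_def)
  have i: "Suc i < n" "i < n" using len by (auto simp: ts_def i_def)
  have ti: "ts ! i = a" "ts ! Suc i = b" by (auto simp: ts_def i_def nth_append)
  have start: "Q a (T $$ (i, Suc i)) 0 b"
    unfolding Q_def using T(1,2) Tc nth i ti
    by (intro exI[of _ T]) (auto simp: upper_triangular_def)
  have dim: "T \<in> carrier_mat n n" if "unimodularly_equivalent n P T" for T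
    using that by (simp add: unimodularly_equivalent_def)
  obtain x' where "Q a' x' 0 b'"
  proof (rule reshape_two_by_two_block[where Q = Q, OF _ _ _ _ start a0 prod common])
    fix r w x y z
    assume "Q w x y z"
    then obtain T where T: "unimodularly_equivalent n P T"
      "\<And>r c. r < n \<Longrightarrow> c < r \<Longrightarrow> \<not> (r = Suc i \<and> c = i) \<Longrightarrow> T $$ (r, c) = 0"
      "\<And>r. r < n \<Longrightarrow> r \<noteq> i \<Longrightarrow> r \<noteq> Suc i \<Longrightarrow> T $$ (r, r) = ts ! r"
      "T $$ (i, i) = w" "T $$ (i, Suc i) = x" "T $$ (Suc i, i) = y" "T $$ (Suc i, Suc i) = z"
      unfolding Q_def by blast
    note d = carrier_matD[OF dim[OF T(1)]]
    show "Q (r * y + w) (r * z + x) y z"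
      unfolding Q_def using unimodularly_equivalent_addrow[OF T(1), of i "Suc i" r] i T d
      by (intro exI[of _ "addrow r i (Suc i) T"]) auto
    show "Q w x (r * w + y) (r * x + z)"
      unfolding Q_def using unimodularly_equivalent_addrow[OF T(1), of "Suc i" i r] i T d
      by (intro exI[of _ "addrow r (Suc i) i T"]) auto
    show "Q (r * x + w) x (r * z + y) z"
      unfolding Q_def using unimodularly_equivalent_addcol[OF T(1), of i "Suc i" r] i T d
      by (intro exI[of _ "addcol r i (Suc i) T"]) auto
    show "Q w (r * w + x) y (r * y + z)"
      unfolding Q_def using unimodularly_equivalent_addcol[OF T(1), of "Suc i" i r] i T d
      by (intro exI[of _ "addcol r (Suc i) i T"]) auto
  qed auto
  then obtain T' where T': "unimodularly_equivalent n P T'"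
      "\<forall>r c. r < n \<longrightarrow> c < r \<longrightarrow> \<not> (r = Suc i \<and> c = i) \<longrightarrow> T' $$ (r, c) = 0"
      "\<forall>r<n. r \<noteq> i \<longrightarrow> r \<noteq> Suc i \<longrightarrow> T' $$ (r, r) = ts ! r"
      "T' $$ (i, i) = a'" "T' $$ (Suc i, i) = 0" "T' $$ (Suc i, Suc i) = b'"
    unfolding Q_def by blast
  note d = carrier_matD[OF dim[OF T'(1)]]
  have "T' $$ (r, r) = (ys @ a' # b' # zs) ! r" if "r < n" for r
  proof -
    have elsewhere: "T' $$ (r, r) = ts ! r" if "r \<noteq> i" "r \<noteq> Suc i"
      using T'(3) \<open>r < n\<close> that by blast
    consider "r < i" | "r = i" | "r = Suc i" | "Suc i < r" by linarith
    then show ?thesis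
    proof cases
      case 4
      then obtain m where m: "r = Suc (Suc i + m)" using less_imp_Suc_add by blast
      then have "ts ! r = (ys @ a' # b' # zs) ! r" by (simp add: ts_def i_def nth_append)
      then show ?thesis using elsewhere 4 by simp
    qed (use elsewhere T'(4,6) in \<open>auto simp: ts_def i_def nth_append\<close>)
  qed
  then have "diag_mat T' = ys @ a' # b' # zs"
    using len d by (intro nth_equalityI) (auto simp: diag_mat_def ts_def)
  moreover have "upper_triangular T'" using T'(2,5) d by (fastforce simp: upper_triangular_def)
  ultimately show ?thesis using T'(1) unfolding has_triangular_diagonal_def by blast
qed

lemma has_triangular_diagonal_nonzero:
  assumes "has_triangular_diagonal n P ts" "det P \<noteq> 0"
  shows "0 \<notin> set ts"
proof -
  from assms obtain T where T: "unimodularly_equivalent n P T" "upper_triangular T" "diag_mat T = ts"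
    unfolding has_triangular_diagonal_def by blast
  have "T \<in> carrier_mat n n" using T(1) by (simp add: unimodularly_equivalent_def)
  then have "det T = prod_list ts" using det_upper_triangular[OF T(2)] T(3) by simp
  moreover obtain c where "c \<noteq> 0" "det T = smult c (det P)"
    using unimodularly_equivalent_det[OF T(1)] by blast
  ultimately show ?thesis using assms(2) by (metis prod_list_zero_iff smult_eq_0_iff)
qed

text \<open>
  Exchanging two neighbouring diagonal entries is a special case of replacing them by a pair with the
  same product. Hence the diagonal matters only as a multiset, and any two entries can be treated as
  neighbours.
\<close>

lemma has_triangular_diagonal_mset:
  assumes "det P \<noteq> 0" "has_triangular_diagonal n P ts" "mset ts = mset ts'"
  shows "has_triangular_diagonal n P ts'"
proof -
  let ?R = "has_triangular_diagonal n P"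
  have swap: "?R (ys @ b # a # zs)" if "?R (ys @ a # b # zs)" for ys a b zs
    using has_triangular_diagonal_adjacent[OF that, of b a]
      has_triangular_diagonal_nonzero[OF that assms(1)] by (auto simp: mult.commute)
  have bubble: "?R (ys @ us @ x # zs)" if "?R (ys @ x # us @ zs)" for ys us x zs
    using that
  proof (induction us arbitrary: ys)
    case (Cons u us)
    from swap[of ys x u "us @ zs"] Cons.prems have "?R ((ys @ [u]) @ x # us @ zs)" by simp
    from Cons.IH[OF this] show ?case by simp
  qed simp
  have "?R (ys @ us')" if "?R (ys @ us)" "mset us = mset us'" for ys us us'
    using that
  proof (induction us arbitrary: ys us')
    case (Cons x us)
    have "x \<in> set us'" using Cons.prems(2) by (metis list.set_intros(1) set_mset_mset)
    then obtain v w where us': "us' = v @ x # w" by (meson split_list)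
    have "?R ((ys @ [x]) @ us)" "mset us = mset (v @ w)" using Cons.prems us' by auto
    then have "?R ((ys @ [x]) @ v @ w)" by (rule Cons.IH)
    then show ?case using bubble[of ys x v w] us' by simp
  qed simp
  from this[of "[]"] show ?thesis using assms by simp
qed

lemma has_triangular_diagonal_replace_pair:
  assumes "det P \<noteq> 0" "has_triangular_diagonal n P ts"
    and ij: "i < length ts" "j < length ts" "i \<noteq> j"
    and prod: "a' * b' = ts ! i * ts ! j"
    and common: "\<And>\<delta>. \<delta> dvd ts ! i \<Longrightarrow> \<delta> dvd ts ! j \<Longrightarrow> \<delta> dvd a' \<and> \<delta> dvd b'"
  shows "has_triangular_diagonal n P (ts[i := a', j := b'])"
proof -
  define I where "I = mset_set ({..<length ts} - {i, j})"
  have split: "mset xs = add_mset (xs ! i) (add_mset (xs ! j) (image_mset ((!) xs) I))"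
    if "length xs = length ts" for xs :: "'a poly list"
  proof -
    have "mset xs = image_mset ((!) xs) (mset_set {..<length ts})"
      using that by (metis map_nth mset_map mset_upt lessThan_atLeast0)
    also have "{..<length ts} = insert i (insert j ({..<length ts} - {i, j}))" using ij by auto
    also have "mset_set \<dots> = add_mset i (add_mset j I)" using ij by (simp add: I_def)
    finally show ?thesis by simp
  qed
  obtain us where us: "mset us = image_mset ((!) ts) I" using ex_mset by blast
  have 1: "has_triangular_diagonal n P ([] @ ts ! i # ts ! j # us)"
    by (rule has_triangular_diagonal_mset[OF assms(1,2)]) (simp add: us split[of ts])
  have "ts ! i \<noteq> 0" using has_triangular_diagonal_nonzero[OF assms(2,1)] ij by (metis nth_mem)
  from has_triangular_diagonal_adjacent[OF 1 this prod common]
  have 2: "has_triangular_diagonal n P ([] @ a' # b' # us)" .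
  have "image_mset ((!) (ts[i := a', j := b'])) I = image_mset ((!) ts) I"
    by (rule image_mset_cong) (auto simp: I_def)
  then show ?thesis
    using ij by (intro has_triangular_diagonal_mset[OF assms(1) 2]) (simp add: us split[of "ts[i := a', j := b']"])
qed

text \<open>
  The diagonals of all triangular matrices equivalent to \<open>P\<close> have the same irreducible factors in total,
  since their products all agree with \<open>det P\<close> up to a constant. This applies in particular to the Smith
  form.
\<close>

lemma has_triangular_diagonal_factors:
  fixes P :: "'a::field poly mat"
  assumes R: "has_triangular_diagonal n P ts" and "det P \<noteq> 0"
  shows "length ts = n" "\<And>i. i < n \<Longrightarrow> ts ! i \<noteq> 0"
    and "(\<Sum>i<n. irreducible_factors (ts ! i)) = irreducible_factors (det P)"
proof -
  from R obtain T where T: "unimodularly_equivalent n P T" "upper_triangular T" "diag_mat T = ts"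
    unfolding has_triangular_diagonal_def by blast
  have Tc: "T \<in> carrier_mat n n" using T(1) by (simp add: unimodularly_equivalent_def)
  show len: "length ts = n" using T(3) Tc by (auto simp: diag_mat_def)
  show nz: "ts ! i \<noteq> 0" if "i < n" for i
    using has_triangular_diagonal_nonzero[OF assms] len that by (metis nth_mem)
  obtain c where c: "c \<noteq> 0" "det T = smult c (det P)"
    using unimodularly_equivalent_det[OF T(1)] by blast
  have "det T = (\<Prod>i<n. ts ! i)"
    using det_upper_triangular[OF T(2) Tc] len
    by (simp add: T(3) prod.list_conv_set_nth lessThan_atLeast0)
  then have "irreducible_factors (det T) = (\<Sum>i<n. irreducible_factors (ts ! i))"
    using nz irreducible_factors_prod[of "{..<n}" "(!) ts"] by simp
  then show "(\<Sum>i<n. irreducible_factors (ts ! i)) = irreducible_factors (det P)"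
    using c assms(2) by (simp add: irreducible_factors_smult)
qed

text \<open>
  The step that connects the matrices with vectors of factor counts: one factor of degree \<open>m\<close> moves
  from the entry with more such factors to the entry with fewer, and the factors of every other degree
  stay where they are.
\<close>

lemma has_triangular_diagonal_transfer:
  fixes P :: "'a::field poly mat"
  assumes R: "has_triangular_diagonal n P ts" and det: "det P \<noteq> 0"
    and ij: "i < n" "j < n"
    and more: "size (factors_of_degree m (ts ! i)) < size (factors_of_degree m (ts ! j))"
  obtains ts' where "has_triangular_diagonal n P ts'"
    "\<And>r m'. r < n \<Longrightarrow> m' \<noteq> m \<Longrightarrow> factors_of_degree m' (ts' ! r) = factors_of_degree m' (ts ! r)"
    "\<And>r. r < n \<Longrightarrow> int (size (factors_of_degree m (ts' ! r))) =
      ((\<lambda>r. int (size (factors_of_degree m (ts ! r))))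
        (i := int (size (factors_of_degree m (ts ! i))) + 1,
         j := int (size (factors_of_degree m (ts ! j))) - 1)) r"
proof -
  note facts = has_triangular_diagonal_factors[OF R det]
  have neq: "i \<noteq> j" using more by auto
  obtain a p where p: "ts ! j = p * a" "irreducible p" "lead_coeff p = 1" "degree p = m"
    and common: "\<And>\<delta>. \<delta> dvd ts ! j \<Longrightarrow> \<delta> dvd ts ! i \<Longrightarrow> \<delta> dvd a \<and> \<delta> dvd p * ts ! i"
    using transfer_irreducible_factor[OF facts(2)[OF ij(2)] facts(2)[OF ij(1)] more] by metis
  let ?ts = "ts[j := a, i := p * ts ! i]"
  have R': "has_triangular_diagonal n P ?ts"
    using ij neq common facts(1) p(1)
    by (intro has_triangular_diagonal_replace_pair[OF det R]) (auto simp: mult_ac)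
  have nz: "ts ! i \<noteq> 0" "p \<noteq> 0" "a \<noteq> 0" using facts(2)[OF ij(1)] facts(2)[OF ij(2)] p(1) by auto
  have Fp: "factors_of_degree m' p = (if m' = m then {#p#} else {#})" for m'
    using p by (auto simp: factors_of_degree_def irreducible_factors_monic_irreducible)
  have fi: "factors_of_degree m' (p * ts ! i) =
      (if m' = m then {#p#} else {#}) + factors_of_degree m' (ts ! i)" for m'
    using nz by (simp add: factors_of_degree_mult Fp)
  have fj: "factors_of_degree m' (ts ! j) =
      (if m' = m then {#p#} else {#}) + factors_of_degree m' a" for m'
    using nz by (simp add: p(1) factors_of_degree_mult Fp)
  show thesis
  proof (rule that[OF R'])
    show "factors_of_degree m' (?ts ! r) = factors_of_degree m' (ts ! r)" if "r < n" "m' \<noteq> m" for r m'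
      using that ij neq facts(1) fi[of m'] fj[of m'] by (auto simp: nth_list_update)
    show "int (size (factors_of_degree m (?ts ! r))) =
      ((\<lambda>r. int (size (factors_of_degree m (ts ! r))))
        (i := int (size (factors_of_degree m (ts ! i))) + 1,
         j := int (size (factors_of_degree m (ts ! j))) - 1)) r" if "r < n" for r
      using that ij neq facts(1) fi[of m] fj[of m] by (auto simp: nth_list_update)
  qed
qed


section \<open>The determinant of a strictly regular matrix polynomial\<close>

lemma coeff_mult_degree_bound:
  fixes p q :: "'a::comm_semiring_1 poly"
  assumes "degree p \<le> d" "degree q \<le> e"
  shows "coeff (p * q) (d + e) = coeff p d * coeff q e"
proof (cases "degree p = d \<and> degree q = e")
  case True
  then show ?thesis using coeff_mult_degree_sum by blast
next
  case False
  then have "coeff p d = 0 \<or> coeff q e = 0" "degree p + degree q < d + e"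
    using assms by (auto simp: coeff_eq_0)
  moreover from this have "coeff (p * q) (d + e) = 0"
    using degree_mult_le[of p q] by (intro coeff_eq_0) linarith
  ultimately show ?thesis by auto
qed

lemma coeff_prod_degree_bound:
  fixes p :: "'b \<Rightarrow> 'a::comm_semiring_1 poly"
  assumes "finite A" "\<And>i. i \<in> A \<Longrightarrow> degree (p i) \<le> d"
  shows "degree (prod p A) \<le> card A * d \<and> coeff (prod p A) (card A * d) = (\<Prod>i\<in>A. coeff (p i) d)"
  using assms
proof (induction A rule: finite_induct)
  case (insert x F)
  have "degree (p x * prod p F) \<le> d + card F * d"
    using insert by (meson add_le_mono degree_mult_le insertI1 insertI2 le_trans)
  moreover have "coeff (p x * prod p F) (d + card F * d) = coeff (p x) d * coeff (prod p F) (card F * d)"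
    using insert by (intro coeff_mult_degree_bound) auto
  ultimately show ?case using insert by simp
qed simp

text \<open>
  The coefficient of \<open>\<lambda>\<^sup>n\<^sup>d\<close> in \<open>det P\<close> is the determinant of the coefficient of \<open>\<lambda>\<^sup>d\<close> in \<open>P\<close>: in each term of
  the Leibniz formula only the top coefficients of the \<open>n\<close> factors contribute.
\<close>

lemma degree_det_strictly_regular:
  fixes P :: "'a::field poly mat"
  assumes "strictly_regular n d P"
  shows "det P \<noteq> 0" "degree (det P) = n * d"
proof -
  from assms have P: "P \<in> carrier_mat n n" and det: "det (matpoly_coeff P d) \<noteq> 0"
    and high: "\<And>m. d < m \<Longrightarrow> matpoly_coeff P m = 0\<^sub>m n n"
    unfolding strictly_regular_def has_degree_def by auto
  have deg: "degree (P $$ (i, j)) \<le> d" if "i < n" "j < n" for i j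
  proof (rule degree_le, intro allI impI)
    fix m assume "d < m"
    from arg_cong[OF high[OF this], of "\<lambda>A. A $$ (i, j)"] that P
    show "coeff (P $$ (i, j)) m = 0" by (simp add: matpoly_coeff_def)
  qed
  have sgn: "coeff (signof p * q) m = signof p * coeff q m" for p :: "nat \<Rightarrow> nat" and q :: "'a poly" and m
    by (simp add: sign_def)
  have "coeff (det P) (n * d) = (\<Sum>p | p permutes {0..<n}. signof p * (\<Prod>i=0..<n. coeff (P $$ (i, p i)) d))"
    unfolding det_def'[OF P] coeff_sum
  proof (rule sum.cong[OF refl])
    fix p assume "p \<in> {p. p permutes {0..<n}}"
    then have "p i < n" if "i < n" for i using that permutes_in_image[of p "{0..<n}" i] by auto
    then have "coeff (\<Prod>i=0..<n. P $$ (i, p i)) (n * d) = (\<Prod>i=0..<n. coeff (P $$ (i, p i)) d)"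
      using coeff_prod_degree_bound[of "{0..<n}" "\<lambda>i. P $$ (i, p i)" d] deg by simp
    then show "coeff (signof p * (\<Prod>i=0..<n. P $$ (i, p i))) (n * d) =
        signof p * (\<Prod>i=0..<n. coeff (P $$ (i, p i)) d)" unfolding sgn by simp
  qed
  also have "\<dots> = det (matpoly_coeff P d)"
  proof -
    have M: "matpoly_coeff P d \<in> carrier_mat n n" using P by (simp add: matpoly_coeff_def)
    show ?thesis unfolding det_def'[OF M]
    proof (rule sum.cong[OF refl])
      fix p assume "p \<in> {p. p permutes {0..<n}}"
      then have "p i < n" if "i < n" for i using that permutes_in_image[of p "{0..<n}" i] by auto
      then show "signof p * (\<Prod>i=0..<n. coeff (P $$ (i, p i)) d) =
          signof p * (\<Prod>i=0..<n. matpoly_coeff P d $$ (i, p i))"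
        using P by (auto simp: matpoly_coeff_def intro!: prod.cong)
    qed
  qed
  finally have "coeff (det P) (n * d) \<noteq> 0" using det by simp
  then show "det P \<noteq> 0" "degree (det P) = n * d"
    using le_degree[of "det P" "n * d"] degree_det_le[of n P d] deg P
    by (auto simp: mult.commute)
qed


section \<open>Divisibility of minors\<close>

text \<open>
  The largest of \<open>l\<close> indices is at least \<open>l - 1\<close>, so by the divisibility chain \<open>s (l - 1)\<close> divides the
  term at that index, and induction applies to the remaining indices.
\<close>

lemma prefix_prod_dvd:
  fixes s :: "nat \<Rightarrow> 'a::comm_semiring_1"
  assumes chain: "\<And>i j. i \<le> j \<Longrightarrow> j < n \<Longrightarrow> s i dvd s j"
    and "K \<subseteq> {..<n}" "card K = l"
  shows "(\<Prod>i<l. s i) dvd (\<Prod>i\<in>K. s i)"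
  using assms(2,3)
proof (induction l arbitrary: K)
  case (Suc l)
  have fin: "finite K" using Suc.prems finite_subset by blast
  have ne: "K \<noteq> {}" using Suc.prems by auto
  let ?m = "Max K"
  have m: "?m \<in> K" using fin ne by simp
  have "K \<subseteq> {..?m}" using fin by auto
  then have "Suc l \<le> Suc ?m" using Suc.prems card_mono[of "{..?m}" K] by simp
  then have "s l dvd s ?m" using chain[of l ?m] m Suc.prems by auto
  moreover have "(\<Prod>i<l. s i) dvd (\<Prod>i\<in>K - {?m}. s i)"
    using Suc m fin by (intro Suc.IH) auto
  ultimately have "(\<Prod>i<l. s i) * s l dvd (\<Prod>i\<in>K - {?m}. s i) * s ?m" by (intro mult_dvd_mono)
  then show ?case using prod.remove[OF fin m, of s] by (simp add: mult.commute)
qed simp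

text \<open>
  The divisibility half of the theory of determinantal divisors, in the form needed for a product
  \<open>X S Y\<close> with \<open>S\<close> diagonal. Expanding the determinant linearly in its rows gives one term for every
  choice of a row \<open>f i\<close> of \<open>Y\<close> for each row \<open>i\<close>. If \<open>f\<close> is injective, the term contains \<open>l\<close> distinct
  \<open>s (f i)\<close>; otherwise two rows coincide and the determinant vanishes.
\<close>

lemma prefix_prod_dvd_minor:
  fixes s :: "nat \<Rightarrow> 'a::comm_ring_1"
  assumes chain: "\<And>i j. i \<le> j \<Longrightarrow> j < n \<Longrightarrow> s i dvd s j"
  shows "(\<Prod>i<l. s i) dvd det (mat l l (\<lambda>(a, b). \<Sum>k<n. X a k * s k * Y k b))"
proof -
  define y where "y k = vec l (Y k)" for k
  define v where "v a k = (X a k * s k) \<cdot>\<^sub>v y k" for a k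
  let ?F = "{f. (\<forall>i\<in>{0..<l}. f i \<in> {..<n}) \<and> (\<forall>i. i \<notin> {0..<l} \<longrightarrow> f i = i)}"
  have v: "v a k \<in> carrier_vec l" for a k by (simp add: v_def y_def)
  have "mat l l (\<lambda>(a, b). \<Sum>k<n. X a k * s k * Y k b) =
      mat\<^sub>r l l (\<lambda>a. finsum_vec TYPE('a) l (v a) {..<n})"
    by (intro eq_matI) (auto simp: index_finsum_vec v v_def y_def)
  also have "det \<dots> = (\<Sum>f\<in>?F. det (mat\<^sub>r l l (\<lambda>i. v i (f i))))"
    by (rule det_linear_rows_sum) (auto simp: v)
  also have "(\<Prod>i<l. s i) dvd \<dots>"
  proof (rule dvd_sum)
    fix f assume f: "f \<in> ?F"
    have eq: "det (mat\<^sub>r l l (\<lambda>i. v i (f i))) =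
        (\<Prod>i=0..<l. X i (f i) * s (f i)) * det (mat\<^sub>r l l (\<lambda>i. y (f i)))"
      unfolding v_def by (rule det_rows_mul) (auto simp: y_def)
    show "(\<Prod>i<l. s i) dvd det (mat\<^sub>r l l (\<lambda>i. v i (f i)))"
    proof (cases "inj_on f {0..<l}")
      case True
      have "(\<Prod>i<l. s i) dvd (\<Prod>k\<in>f ` {0..<l}. s k)"
        using f True by (intro prefix_prod_dvd[OF chain]) (auto simp: card_image)
      also have "\<dots> = (\<Prod>i=0..<l. s (f i))" by (simp add: prod.reindex[OF True])
      finally show ?thesis unfolding eq by (simp add: prod.distrib)
    next
      case False
      then obtain i j where ij: "i < l" "j < l" "i \<noteq> j" "f i = f j" by (auto simp: inj_on_def)
      then have "det (mat\<^sub>r l l (\<lambda>i. y (f i))) = 0"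
        by (intro det_identical_rows[OF _ ij(3,1,2)]) (auto simp: y_def)
      then show ?thesis unfolding eq by simp
    qed
  qed
  finally show ?thesis .
qed

lemma index_mult_diagonal_mult:
  fixes X S Y :: "'a::comm_semiring_1 mat"
  assumes "X \<in> carrier_mat n n" "S \<in> carrier_mat n n" "Y \<in> carrier_mat n n" "diagonal_mat S"
    and "i < n" "j < n"
  shows "(X * S * Y) $$ (i, j) = (\<Sum>k<n. X $$ (i, k) * S $$ (k, k) * Y $$ (k, j))"
proof -
  have XS: "(X * S) $$ (i, k) = X $$ (i, k) * S $$ (k, k)" if "k < n" for k
  proof -
    have "(X * S) $$ (i, k) = (\<Sum>m\<in>{0..<n}. X $$ (i, m) * S $$ (m, k))"
      using assms that by (auto simp: scalar_prod_def)
    also have "\<dots> = (\<Sum>m\<in>{0..<n}. if m = k then X $$ (i, k) * S $$ (k, k) else 0)"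
      using assms that by (intro sum.cong) (auto simp: diagonal_mat_def)
    finally show ?thesis using that by simp
  qed
  have "(Z * Y) $$ (i, j) = (\<Sum>k<n. Z $$ (i, k) * Y $$ (k, j))" if "Z \<in> carrier_mat n n" for Z
    using that assms by (auto simp: scalar_prod_def lessThan_atLeast0)
  then have "(X * S * Y) $$ (i, j) = (\<Sum>k<n. (X * S) $$ (i, k) * Y $$ (k, j))"
    using assms by (meson mult_carrier_mat)
  also have "\<dots> = (\<Sum>k<n. X $$ (i, k) * S $$ (k, k) * Y $$ (k, j))"
    by (rule sum.cong) (simp_all only: XS lessThan_iff)
  finally show ?thesis .
qed

text \<open>
  The diagonal entries with indices in \<open>I\<close> multiply to a principal minor of \<open>T\<close>, because a principal
  submatrix of a triangular matrix is triangular.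
\<close>

lemma prefix_prod_dvd_triangular_diagonal:
  fixes X S Y T :: "'a::comm_ring_1 mat"
  assumes carrier: "X \<in> carrier_mat n n" "S \<in> carrier_mat n n" "Y \<in> carrier_mat n n"
    and S: "diagonal_mat S" and chain: "\<And>i j. i \<le> j \<Longrightarrow> j < n \<Longrightarrow> S $$ (i, i) dvd S $$ (j, j)"
    and T: "T = X * S * Y" "upper_triangular T"
    and I: "I \<subseteq> {..<n}" "card I = l"
  shows "(\<Prod>i<l. S $$ (i, i)) dvd (\<Prod>i\<in>I. T $$ (i, i))"
proof -
  have fin: "finite I" using I(1) finite_subset by blast
  define \<iota> where "\<iota> a = sorted_list_of_set I ! a" for a
  have len: "length (sorted_list_of_set I) = l" using I by simp
  have mem: "\<iota> a \<in> I" if "a < l" for a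
    using that len fin by (metis \<iota>_def nth_mem set_sorted_list_of_set)
  then have lt: "\<iota> a < n" if "a < l" for a using that I by auto
  have mono: "\<iota> a < \<iota> b" if "a < b" "b < l" for a b
    using that len sorted_wrt_nth_less[OF strict_sorted_list_of_set[of I]]
    unfolding \<iota>_def by auto
  have dimT: "dim_row T = n" using T(1) carrier by simp
  let ?N = "mat l l (\<lambda>(a, b). T $$ (\<iota> a, \<iota> b))"
  have "?N = mat l l (\<lambda>(a, b). \<Sum>k<n. X $$ (\<iota> a, k) * S $$ (k, k) * Y $$ (k, \<iota> b))"
    unfolding T(1) by (intro cong_mat) (auto simp: index_mult_diagonal_mult[OF carrier S] lt)
  then have dvd: "(\<Prod>i<l. S $$ (i, i)) dvd det ?N"
    using prefix_prod_dvd_minor[of n "\<lambda>k. S $$ (k, k)" l "\<lambda>a k. X $$ (\<iota> a, k)" "\<lambda>k b. Y $$ (k, \<iota> b)"] chain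
    by simp
  have "upper_triangular ?N"
    using T(2) mono lt dimT by (auto simp: upper_triangular_def)
  then have "det ?N = (\<Prod>a\<in>{0..<l}. T $$ (\<iota> a, \<iota> a))"
    by (subst det_upper_triangular[of _ l]) (auto simp: prod_list_diag_prod)
  also have "\<dots> = (\<Prod>i\<in>\<iota> ` {0..<l}. T $$ (i, i))"
    by (subst prod.reindex) (auto simp: inj_on_def, metis mono nat_neq_iff)
  also have "\<iota> ` {0..<l} = I"
  proof -
    have "\<iota> ` {0..<l} = set (sorted_list_of_set I)"
      using len by (auto simp: \<iota>_def in_set_conv_nth)
    then show ?thesis using fin by simp
  qed
  finally show ?thesis using dvd by simp
qed


section \<open>Reducing the entries above the diagonal\<close>

text \<open>
  When all diagonal entries have degree \<open>d\<close>, an entry above the diagonal is reduced modulo the diagonal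
  entry of its row by subtracting a multiple of column \<open>i\<close> from column \<open>j\<close>. This changes column \<open>j\<close> in the
  rows up to \<open>i\<close> only, so going through the rows from bottom to top never spoils an entry that has
  already been reduced.
\<close>

lemma triangularization_of_constant_degree_diagonal:
  fixes P :: "'a::field poly mat"
  assumes R: "has_triangular_diagonal n P ts" and n: "n \<ge> 1"
    and nz: "0 \<notin> set ts" and deg: "\<And>t. t \<in> set ts \<Longrightarrow> degree t = d"
  shows "\<exists>T. is_triangularization n d P T"
proof -
  \<comment> \<open>The position of \<open>(i, j)\<close> in the order of processing: row by row, from the bottom row upwards.\<close>
  define code where "code i j = (n - 1 - i) * n + j" for i j
  have "\<exists>T. unimodularly_equivalent n P T \<and> upper_triangular T \<and> diag_mat T = ts \<and>
      (\<forall>i j. i < j \<longrightarrow> j < n \<longrightarrow> code i j < N \<longrightarrow> degree (T $$ (i, j)) \<le> d)" for N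
  proof (induction N)
    case 0
    then show ?case using R by (auto simp: has_triangular_diagonal_def)
  next
    case (Suc N)
    then obtain T where T: "unimodularly_equivalent n P T" "upper_triangular T" "diag_mat T = ts"
      and low: "\<And>i j. i < j \<Longrightarrow> j < n \<Longrightarrow> code i j < N \<Longrightarrow> degree (T $$ (i, j)) \<le> d" by blast
    show ?case
    proof (cases "\<exists>i j. i < j \<and> j < n \<and> code i j = N")
      case False
      then have "\<forall>i j. i < j \<longrightarrow> j < n \<longrightarrow> code i j < Suc N \<longrightarrow> degree (T $$ (i, j)) \<le> d"
        using low by (metis less_Suc_eq)
      with T show ?thesis by blast
    next
      case True
      then obtain i j where ij: "i < j" "j < n" "code i j = N" by blast
      have Tc: "T \<in> carrier_mat n n" using T(1) by (simp add: unimodularly_equivalent_def)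
      have "T $$ (i, i) \<in> set ts" using T(3) Tc ij by (auto simp: diag_mat_def)
      then have t: "T $$ (i, i) \<noteq> 0" "degree (T $$ (i, i)) = d" using nz deg by auto
      define q where "q = - (T $$ (i, j) div T $$ (i, i))"
      let ?T = "addcol q j i T"
      have ent: "?T $$ (r, c) = (if c = j then q * T $$ (r, i) + T $$ (r, j) else T $$ (r, c))"
        if "r < n" "c < n" for r c using that Tc by auto
      have "unimodularly_equivalent n P ?T"
        using unimodularly_equivalent_addcol[OF T(1), of j i q] ij by simp
      moreover have ut: "T $$ (r, c) = 0" if "c < r" "r < n" for r c
        using T(2) Tc that by (auto simp: upper_triangular_def)
      have "upper_triangular ?T"
        using Tc ij ut by (auto simp: upper_triangular_def)
      moreover have "diag_mat ?T = diag_mat T"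
        using Tc ij ut by (auto simp: diag_mat_def)
      moreover have "degree (?T $$ (r, c)) \<le> d" if rc: "r < c" "c < n" "code r c < Suc N" for r c
      proof (cases "c = j")
        case False
        have "code r c \<noteq> code i j"
        proof
          assume "code r c = code i j"
          moreover have "code r c mod n = c" "code i j mod n = j" using rc ij(2) by (auto simp: code_def)
          ultimately show False using False by simp
        qed
        then show ?thesis using low[OF rc(1,2)] rc ij False by (auto simp: ent)
      next
        case True
        have "\<not> r < i"
        proof
          assume "r < i"
          then have "n - 1 - i < n - 1 - r" using ij by linarith
          then have "code i j < code r c" using n by (simp add: code_def True)
          with rc ij show False by simp
        qed
        then consider "r = i" | "i < r" by linarith
        then show ?thesis
        proof cases
          case 1
          have "?T $$ (r, c) = T $$ (i, j) mod T $$ (i, i)"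
            using rc by (simp add: ent True 1) (simp add: q_def minus_div_mult_eq_mod[symmetric])
          then show ?thesis using degree_mod_less[OF t(1), of "T $$ (i, j)"] t(2) by auto
        next
          case 2
          then have "n - 1 - r < n - 1 - i" using rc by linarith
          then have "code r c < N" using n by (simp add: code_def True ij(3)[symmetric])
          then show ?thesis using low[OF rc(1,2)] rc ut[of i r] 2 by (simp add: ent True)
        qed
      qed
      ultimately show ?thesis using T(3) by (intro exI[of _ ?T]) auto
    qed
  qed
  from this[of "n * n"] obtain T where T: "unimodularly_equivalent n P T" "upper_triangular T"
    "diag_mat T = ts"
    and low: "\<And>i j. i < j \<Longrightarrow> j < n \<Longrightarrow> code i j < n * n \<Longrightarrow> degree (T $$ (i, j)) \<le> d" by blast
  have Tc: "T \<in> carrier_mat n n" using T(1) by (simp add: unimodularly_equivalent_def)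
  have diag: "T $$ (i, i) \<in> set ts" if "i < n" for i using T(3) Tc that by (auto simp: diag_mat_def)
  have deg_T: "degree (T $$ (i, j)) \<le> d" if "i < n" "j < n" for i j
  proof -
    consider "j < i" | "j = i" | "i < j" by linarith
    then show ?thesis
    proof cases
      case 1
      then show ?thesis using T(2) Tc that by (auto simp: upper_triangular_def)
    next
      case 2
      then show ?thesis using deg diag that by auto
    next
      case 3
      have "code i j < Suc (n - 1 - i) * n" using that by (simp add: code_def)
      also have "\<dots> \<le> n * n" using that by (intro mult_le_mono1) simp
      finally show ?thesis using low 3 that by blast
    qed
  qed
  have "has_degree T d"
    unfolding has_degree_def
  proof (intro conjI allI impI)
    have "degree (T $$ (0, 0)) = d" "T $$ (0, 0) \<noteq> 0" using diag[of 0] deg nz n by auto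
    then have "coeff (T $$ (0, 0)) d \<noteq> 0" by auto
    then show "matpoly_coeff T d \<noteq> 0\<^sub>m (dim_row T) (dim_col T)"
      using Tc n by (auto simp: matpoly_coeff_def dest!: arg_cong[of _ _ "\<lambda>A. A $$ (0, 0)"])
    fix m assume "d < m"
    then show "matpoly_coeff T m = 0\<^sub>m (dim_row T) (dim_col T)"
      using Tc deg_T by (intro eq_matI) (auto simp: matpoly_coeff_def intro!: coeff_eq_0 intro: le_less_trans)
  qed
  with T show ?thesis by (auto simp: is_triangularization_def)
qed


section \<open>Stacking\<close>

text \<open>
  Stacking distributes a list of length \<open>M n\<close> over \<open>n\<close> columns, so summing column by column exhausts it.
\<close>

lemma sum_columns_eq_sum:
  fixes g :: "nat \<Rightarrow> 'b::comm_monoid_add"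
  shows "(\<Sum>i<n. \<Sum>j<M. g (j * n + i)) = (\<Sum>l<M * n. g l)"
proof -
  have "(\<Sum>i<n. g (j * n + i)) = sum g {j * n..<j * n + n}" for j
    using sum.shift_bounds_nat_ivl[of g 0 "j * n" n] by (simp add: lessThan_atLeast0 add.commute)
  then have "(\<Sum>j<M. \<Sum>i<n. g (j * n + i)) = (\<Sum>l<M * n. g l)" by (simp add: sum.nat_group)
  then show ?thesis by (subst sum.swap)
qed

text \<open>
  The stacked polynomials share out the elements of \<open>F\<close> among themselves, and the constants 1
  contribute no factors. The degrees of the stacked polynomials do not increase with the index
  because the factors are listed in order of nonincreasing degree.
\<close>

lemma stacking_properties:
  fixes F :: "'a::field poly multiset"
  assumes F: "\<forall>p\<in>#F. irreducible p \<and> lead_coeff p = 1 \<and> degree p = k"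
    and st: "is_stacking n F qs"
  shows "length qs = n"
    and "\<And>i. i < n \<Longrightarrow> degree (qs ! i) = k * size (factors_of_degree k (qs ! i))"
    and "\<And>i j. i \<le> j \<Longrightarrow> j < n \<Longrightarrow> degree (qs ! j) \<le> degree (qs ! i)"
    and "(\<Sum>i<n. size (factors_of_degree k (qs ! i))) = size F"
proof -
  from st obtain r a where a: "mset a = F + replicate_mset r 1" "n dvd length a"
      "sorted_wrt (\<lambda>p q. degree p \<ge> degree q) a"
      "qs = map (\<lambda>i. \<Prod>j<length a div n. a ! (j * n + i)) [0..<n]"
    unfolding is_stacking_def by blast
  define M where "M = length a div n"
  have len: "length a = M * n" using a(2) by (simp add: M_def)
  have idx: "j * n + i < length a" if "j < M" "i < n" for i j
  proof -
    have "j * n + i < Suc j * n" using that by simp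
    also have "\<dots> \<le> M * n" using that by (intro mult_le_mono1) simp
    finally show ?thesis by (simp add: len)
  qed
  have qs: "qs ! i = (\<Prod>j<M. a ! (j * n + i))" if "i < n" for i
    using that by (simp add: a(4) M_def)
  show "length qs = n" by (simp add: a(4))
  have "p \<noteq> 0" if "p \<in># mset a" for p
    using that F unfolding a(1) by (auto split: if_splits)
  then have nz: "a ! l \<noteq> 0" if "l < length a" for l using that by (metis nth_mem_mset)
  have Fq: "irreducible_factors (qs ! i) = (\<Sum>j<M. irreducible_factors (a ! (j * n + i)))"
    if "i < n" for i
    unfolding qs[OF that] using nz idx that by (intro irreducible_factors_prod) auto
  have "(\<Sum>i<n. irreducible_factors (qs ! i)) = (\<Sum>l<length a. irreducible_factors (a ! l))"
    using sum_columns_eq_sum[of "\<lambda>l. irreducible_factors (a ! l)" n M] by (simp add: Fq len)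
  also have "\<dots> = sum_list (map irreducible_factors a)"
    by (simp add: sum_list_sum_nth lessThan_atLeast0)
  also have "\<dots> = (\<Sum>p\<in>#mset a. irreducible_factors p)"
    by (metis mset_map sum_mset_sum_list)
  also have "\<dots> = (\<Sum>p\<in>#F. {#p#})"
  proof -
    have "image_mset irreducible_factors F = image_mset (\<lambda>p. {#p#}) F"
      using F by (intro image_mset_cong irreducible_factors_monic_irreducible) blast+
    then show ?thesis unfolding a(1) by (simp add: irreducible_factors_one)
  qed
  also have "\<dots> = F" by (induction F) auto
  finally have total: "(\<Sum>i<n. irreducible_factors (qs ! i)) = F" .
  have deg: "degree p = k" if "i < n" "p \<in># irreducible_factors (qs ! i)" for i p
  proof -
    have "p \<in># (\<Sum>i<n. irreducible_factors (qs ! i))" using that by (auto simp: set_mset_sum)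
    then show ?thesis using F unfolding total by simp
  qed
  have fod: "factors_of_degree k (qs ! i) = irreducible_factors (qs ! i)" if "i < n" for i
    unfolding factors_of_degree_def using deg[OF that] by (simp add: filter_mset_eq_conv)
  show "(\<Sum>i<n. size (factors_of_degree k (qs ! i))) = size F"
    by (simp add: fod flip: total size_multiset_sum)
  have qnz: "qs ! i \<noteq> 0" if "i < n" for i using nz idx that by (auto simp: qs)
  show "degree (qs ! i) = k * size (factors_of_degree k (qs ! i))" if "i < n" for i
  proof -
    have "image_mset degree (irreducible_factors (qs ! i)) = image_mset (\<lambda>_. k) (irreducible_factors (qs ! i))"
      using deg[OF that] by (intro image_mset_cong)
    then show ?thesis
      using degree_eq_sum_irreducible_factors[OF qnz[OF that]] fod[OF that] by simp
  qed
  have degq: "degree (qs ! i) = (\<Sum>j<M. degree (a ! (j * n + i)))" if "i < n" for i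
    unfolding qs[OF that] using nz idx that by (intro degree_prod_eq_sum_degree) auto
  show "degree (qs ! j) \<le> degree (qs ! i)" if "i \<le> j" "j < n" for i j
  proof (cases "i = j")
    case False
    then show ?thesis
      using that sorted_wrt_nth_less[OF a(3)] idx by (auto simp: degq intro!: sum_mono)
  qed simp
qed


section \<open>Majorization by the gap vector\<close>

text \<open>
  The factors of degree \<open>k\<close> are brought to the counts \<open>m\<close> first. The moves for one degree leave the
  counts for the other degree in place, so the factors of degree 1 still have their initial counts
  afterwards, and can then be brought to the counts \<open>g\<close>.
\<close>

lemma reachable_factor_counts:
  fixes P :: "'a::field poly mat" and g m :: "nat \<Rightarrow> int"
  assumes det: "det P \<noteq> 0" and R: "has_triangular_diagonal n P ss" and k: "k \<noteq> 1"
    and m_homogeneous: "\<And>i j. i < n \<Longrightarrow> j < n \<Longrightarrow> m i \<le> m j + 1"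
    and m_total: "(\<Sum>i<n. int (size (factors_of_degree k (ss ! i)))) = (\<Sum>i<n. m i)"
    and g_mono: "\<And>i j. i \<le> j \<Longrightarrow> j < n \<Longrightarrow> g i \<le> g j"
    and g_dom: "\<And>l. l \<le> n \<Longrightarrow> (\<Sum>i<l. int (size (factors_of_degree 1 (ss ! i)))) \<le> (\<Sum>i<l. g i)"
    and g_total: "(\<Sum>i<n. int (size (factors_of_degree 1 (ss ! i)))) = (\<Sum>i<n. g i)"
  obtains ts where "has_triangular_diagonal n P ts"
    "\<And>i. i < n \<Longrightarrow> int (size (factors_of_degree 1 (ts ! i))) = g i"
    "\<And>i. i < n \<Longrightarrow> int (size (factors_of_degree k (ts ! i))) = m i"
proof -
  let ?c = "\<lambda>e ts i. int (size (factors_of_degree e (ts ! i)))"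
  have move: "\<exists>ts'. has_triangular_diagonal n P ts' \<and>
      (\<forall>r<n. ?c e ts' r = (u(i := u i + 1, j := u j - 1)) r \<and> ?c e' ts' r = ?c e' ts r)"
    if "has_triangular_diagonal n P ts" "\<forall>r<n. ?c e ts r = u r" "e' \<noteq> e" "i < n" "j < n" "u i < u j"
    for ts u i j e e'
  proof -
    have "size (factors_of_degree e (ts ! i)) < size (factors_of_degree e (ts ! j))"
      using that by (metis of_nat_less_iff)
    from has_triangular_diagonal_transfer[OF that(1) det that(4,5) this]
    obtain ts' where ts': "has_triangular_diagonal n P ts'"
      "\<And>r m'. r < n \<Longrightarrow> m' \<noteq> e \<Longrightarrow> factors_of_degree m' (ts' ! r) = factors_of_degree m' (ts ! r)"
      "\<And>r. r < n \<Longrightarrow> ?c e ts' r = ((?c e ts)(i := ?c e ts i + 1, j := ?c e ts j - 1)) r" by blast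
    show ?thesis using ts' that by (intro exI[of _ ts']) auto
  qed
  define A where "A u \<longleftrightarrow> (\<exists>ts. has_triangular_diagonal n P ts \<and>
    (\<forall>i<n. ?c k ts i = u i \<and> ?c 1 ts i = ?c 1 ss i))" for u :: "nat \<Rightarrow> int"
  define B where "B u \<longleftrightarrow> (\<exists>ts. has_triangular_diagonal n P ts \<and>
    (\<forall>i<n. ?c k ts i = m i \<and> ?c 1 ts i = u i))" for u :: "nat \<Rightarrow> int"
  obtain w where "A w" "\<And>i. i < n \<Longrightarrow> w i = m i"
  proof (rule unit_transfers_reach_homogeneous[of A n "?c k ss" m])
    show "A (u(i := u i + 1, j := u j - 1))" if u: "A u" "i < n" "j < n" "u i < u j" for u i j
    proof -
      from u(1) obtain ts where ts: "has_triangular_diagonal n P ts"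
        "\<forall>i<n. ?c k ts i = u i" "\<forall>i<n. ?c 1 ts i = ?c 1 ss i" unfolding A_def by blast
      from move[OF ts(1,2) k[symmetric] u(2-4)] ts(3) show ?thesis unfolding A_def by metis
    qed
    show "A (?c k ss)" using R unfolding A_def by blast
  qed (use m_homogeneous m_total in auto)
  then have "B (?c 1 ss)" unfolding A_def B_def by auto
  obtain v where "B v" "\<And>i. i < n \<Longrightarrow> v i = g i"
  proof (rule unit_transfers_reach_nondecreasing[of B n "?c 1 ss" g])
    show "B (u(i := u i + 1, j := u j - 1))" if u: "B u" "i < n" "j < n" "u i < u j" for u i j
    proof -
      from u(1) obtain ts where ts: "has_triangular_diagonal n P ts"
        "\<forall>i<n. ?c 1 ts i = u i" "\<forall>i<n. ?c k ts i = m i" unfolding B_def by blast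
      from move[OF ts(1,2) k u(2-4)] ts(3) show ?thesis unfolding B_def by metis
    qed
  qed (use g_mono g_dom g_total \<open>B (?c 1 ss)\<close> in auto)
  then show thesis using that unfolding B_def by metis
qed

theorem proposition5p7:
  fixes P S :: "'a::field poly mat" and n d k :: nat and qs :: "'a poly list"
  assumes "n \<ge> 1"
    and "strictly_regular n d P"
    and "is_smith_form n P S"
    and "k \<ge> 2"
    and "\<And>p. irreducible_divisor n P p \<Longrightarrow> degree p = 1 \<or> degree p = k"
    and "is_stacking n (smith_factors n k S) qs"
  shows "(\<exists>T. is_triangularization n d P T) \<longleftrightarrow>
         majorizes (factor_count_vector n 1 S) (gap_vector d qs)"
proof -
  note detP = degree_det_strictly_regular[OF assms(2)]
  let ?R = "has_triangular_diagonal n P"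
  let ?c = "\<lambda>m p. size (factors_of_degree m p)"
  define s where "s i = S $$ (i, i)" for i
  have S: "unimodularly_equivalent n P S" "diagonal_mat S"
    "\<And>i. i < n \<Longrightarrow> lead_coeff (s i) = 1" "\<And>i. Suc i < n \<Longrightarrow> s i dvd s (Suc i)"
    using assms(3) by (auto simp: is_smith_form_def s_def)
  have Sc: "S \<in> carrier_mat n n" using S(1) by (simp add: unimodularly_equivalent_def)
  have s_nz: "s i \<noteq> 0" if "i < n" for i using S(3)[OF that] by auto
  have chain: "s i dvd s j" if "i \<le> j" "j < n" for i j
    using that by (induction j rule: dec_induct) (auto intro: dvd_trans S(4))
  have RS: "?R (diag_mat S)"
    using S(1,2) Sc unfolding has_triangular_diagonal_def
    by (intro exI[of _ S]) (auto simp: upper_triangular_def diagonal_mat_def)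
  have diagS: "diag_mat S ! i = s i" if "i < n" for i using Sc that by (simp add: diag_mat_def s_def)
  have sF: "(\<Sum>i<n. irreducible_factors (s i)) = irreducible_factors (det P)"
    using has_triangular_diagonal_factors(3)[OF RS detP(1)] by (simp add: diagS)

  \<comment> \<open>Every irreducible factor of \<open>det P\<close> divides some \<open>s i\<close>, so the hypothesis on degrees covers the
    diagonals of all triangular matrices equivalent to \<open>P\<close>.\<close>
  have deg_factor: "degree q = 1 \<or> degree q = k" if "q \<in># irreducible_factors (det P)" for q
  proof -
    from that obtain i where i: "i < n" "q \<in># irreducible_factors (s i)"
      unfolding sF[symmetric] by (auto simp: set_mset_sum)
    from irreducible_factors_irreducible[OF s_nz[OF i(1)] i(2)]
      irreducible_factors_dvd[OF s_nz[OF i(1)] i(2)] i(1) assms(3)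
    have "irreducible_divisor n P q" unfolding irreducible_divisor_def s_def by blast
    then show ?thesis by (rule assms(5))
  qed
  have degree_t: "degree (ts ! i) = ?c 1 (ts ! i) + k * ?c k (ts ! i)" if "?R ts" "i < n" for ts i
  proof -
    note facts = has_triangular_diagonal_factors[OF that(1) detP(1)]
    have "degree q = 1 \<or> degree q = k" if "q \<in># irreducible_factors (ts ! i)" for q
      using that \<open>i < n\<close> by (intro deg_factor) (auto simp: set_mset_sum simp flip: facts(3))
    then show ?thesis
      using degree_eq_factor_counts[OF facts(2)[OF that(2)], of 1 k] assms(4) by simp
  qed
  have total_t: "(\<Sum>i<n. ?c m (ts ! i)) = (\<Sum>i<n. ?c m (s i))" if "?R ts" for ts m
  proof -
    have "filter_mset Q (\<Sum>i<n. F i) = (\<Sum>i<n. filter_mset Q (F i))"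
      for Q and F :: "nat \<Rightarrow> 'a poly multiset" by (induction n) auto
    then have "(\<Sum>i<n. ?c m (p i)) = size (filter_mset (\<lambda>q. degree q = m) (\<Sum>i<n. irreducible_factors (p i)))"
      for p :: "nat \<Rightarrow> 'a poly" by (simp add: factors_of_degree_def size_multiset_sum)
    then show ?thesis using has_triangular_diagonal_factors(3)[OF that detP(1)] sF by simp
  qed
  have total_degree: "(\<Sum>i<n. degree (ts ! i)) = n * d" if "?R ts" for ts
  proof -
    note facts = has_triangular_diagonal_factors[OF that detP(1)]
    have "(\<Sum>i<n. degree (ts ! i)) = (\<Sum>i<n. \<Sum>q\<in>#irreducible_factors (ts ! i). degree q)"
      using facts(2) by (intro sum.cong) (auto simp: degree_eq_sum_irreducible_factors)
    also have "\<dots> = (\<Sum>q\<in>#(\<Sum>i<n. irreducible_factors (ts ! i)). degree q)"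
      by (induction n) auto
    also have "\<dots> = n * d"
      unfolding facts(3) using degree_eq_sum_irreducible_factors[OF detP(1)] detP(2) by simp
    finally show ?thesis .
  qed

  let ?F = "smith_factors n k S"
  have F: "\<forall>p\<in>#?F. irreducible p \<and> lead_coeff p = 1 \<and> degree p = k"
    using irreducible_factors_irreducible[OF s_nz]
    by (auto simp: smith_factors_def set_mset_sum factors_of_degree_def simp flip: s_def)
  note q = stacking_properties[OF F assms(6)]
  define m where "m i = int (?c k (qs ! i))" for i
  define g where "g i = int d - int k * m i" for i
  define f where "f i = int (?c 1 (s i))" for i
  have m_homogeneous: "m i \<le> m j + 1" if "i < n" "j < n" for i j
  proof -
    have "one_homogeneous (map (?c k) qs)"
      using assms(4) by (intro stacking_one_homogeneous[OF F _ assms(6)]) simp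
    then have "?c k (qs ! i) \<le> ?c k (qs ! j) + 1"
      using that q(1) by (auto simp: one_homogeneous_def)
    then show ?thesis by (simp add: m_def)
  qed
  have size_F: "size ?F = (\<Sum>i<n. ?c k (s i))"
    by (simp add: smith_factors_def size_multiset_sum s_def)
  have m_total: "(\<Sum>i<n. int (?c k (s i))) = (\<Sum>i<n. m i)"
    using q(4) size_F by (simp add: m_def flip: of_nat_sum)
  have g_deg: "g i = int d - int (degree (qs ! i))" if "i < n" for i
    using q(2)[OF that] by (simp add: g_def m_def)
  have g_mono: "g i \<le> g j" if "i \<le> j" "j < n" for i j
    using q(3)[OF that] that by (simp add: g_deg)
  have f_mono: "f i \<le> f j" if "i \<le> j" "j < n" for i j
    using size_mset_mono[OF factors_of_degree_mono[OF chain[OF that]]] s_nz that by (simp add: f_def)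
  have "int (n * d) = (\<Sum>i<n. f i + int k * int (?c k (s i)))"
    using total_degree[OF RS, symmetric] degree_t[OF RS] by (simp add: diagS f_def)
  then have fg_total: "(\<Sum>i<n. f i) = (\<Sum>i<n. g i)"
    using m_total by (simp add: g_def sum.distrib sum_subtractf flip: sum_distrib_left)

  \<comment> \<open>Both vectors are nondecreasing as they stand: the invariant polynomials form a divisibility
    chain, and the stacked polynomials have nonincreasing degrees. So majorization is a comparison of
    prefix sums.\<close>
  have "sorted (factor_count_vector n 1 S)" "sorted (gap_vector d qs)"
    using f_mono g_mono g_deg q(1)
    by (auto simp: sorted_iff_nth_mono factor_count_vector_def gap_vector_def f_def s_def)
  moreover have "length (factor_count_vector n 1 S) = n" "length (gap_vector d qs) = n"
    using q(1) by (auto simp: factor_count_vector_def gap_vector_def)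
  moreover have "factor_count_vector n 1 S ! i = f i" "gap_vector d qs ! i = g i" if "i < n" for i
    using that q(1) g_deg by (auto simp: factor_count_vector_def gap_vector_def f_def s_def)
  ultimately have "majorizes (factor_count_vector n 1 S) (gap_vector d qs) \<longleftrightarrow>
      (\<forall>l\<le>n. (\<Sum>i<l. f i) \<le> (\<Sum>i<l. g i))"
    using fg_total by (subst majorizes_sorted_iff[where n = n]) auto
  also have "\<dots> \<longleftrightarrow> (\<exists>T. is_triangularization n d P T)"
  proof
    assume dom: "\<forall>l\<le>n. (\<Sum>i<l. f i) \<le> (\<Sum>i<l. g i)"
    have pre: "(\<Sum>i<l. int (?c e (diag_mat S ! i))) = (\<Sum>i<l. int (?c e (s i)))" if "l \<le> n" for l e
      using that by (intro sum.cong) (auto simp: diagS)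
    obtain ts where ts: "?R ts" "\<And>i. i < n \<Longrightarrow> int (?c 1 (ts ! i)) = g i"
      "\<And>i. i < n \<Longrightarrow> int (?c k (ts ! i)) = m i"
    proof (rule reachable_factor_counts[OF detP(1) RS, of k m g])
      show "(\<Sum>i<l. int (?c 1 (diag_mat S ! i))) \<le> (\<Sum>i<l. g i)" if "l \<le> n" for l
        using that dom pre[OF that] by (simp add: f_def)
    qed (use assms(4) m_homogeneous g_mono m_total fg_total in \<open>auto simp: pre f_def\<close>)
    note facts = has_triangular_diagonal_factors[OF ts(1) detP(1)]
    have "int (degree (ts ! i)) = int d" if "i < n" for i
      using degree_t[OF ts(1) that] ts(2,3)[OF that] by (simp add: g_def)
    then show "\<exists>T. is_triangularization n d P T"
      using facts(1,2) assms(1)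
      by (intro triangularization_of_constant_degree_diagonal[OF ts(1)]) (auto simp: in_set_conv_nth)
  next
    assume "\<exists>T. is_triangularization n d P T"
    then obtain T where T: "upper_triangular T" "has_degree T d" "unimodularly_equivalent n P T"
      by (auto simp: is_triangularization_def)
    have Tc: "T \<in> carrier_mat n n" using T(3) by (simp add: unimodularly_equivalent_def)
    define t where "t i = T $$ (i, i)" for i
    have RT: "?R (diag_mat T)" using T by (auto simp: has_triangular_diagonal_def)
    have diagT: "diag_mat T ! i = t i" if "i < n" for i using Tc that by (simp add: diag_mat_def t_def)
    have t_nz: "t i \<noteq> 0" if "i < n" for i
      using has_triangular_diagonal_factors(2)[OF RT detP(1) that] diagT[OF that] by simp
    have t_le: "degree (t i) \<le> d" if "i < n" for i
    proof (rule degree_le, intro allI impI)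
      fix j assume "d < j"
      then have "matpoly_coeff T j = 0\<^sub>m n n" using T(2) Tc by (auto simp: has_degree_def)
      from arg_cong[OF this, of "\<lambda>A. A $$ (i, i)"] that Tc
      show "coeff (t i) j = 0" by (simp add: matpoly_coeff_def t_def)
    qed
    \<comment> \<open>The degrees of the \<open>n\<close> diagonal entries are at most \<open>d\<close> and add up to \<open>n d\<close>.\<close>
    have t_deg: "degree (t i) = d" if "i < n" for i
    proof (rule ccontr)
      assume "degree (t i) \<noteq> d"
      then have "(\<Sum>i<n. degree (t i)) < (\<Sum>i<n. d)"
        using t_le that by (intro sum_strict_mono_ex1) (auto intro!: bexI[of _ i] le_neq_implies_less)
      then show False using total_degree[OF RT] by (simp add: diagT)
    qed
    define e where "e i = int (?c k (t i))" for i
    have c_e: "int (?c 1 (t i)) = int d - int k * e i" if "i < n" for i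
      using degree_t[OF RT that] t_deg[OF that] by (simp add: diagT[OF that] e_def)
    have e_total: "(\<Sum>i<n. e i) = (\<Sum>i<n. m i)"
      using total_t[OF RT, of k] m_total by (simp add: diagT e_def flip: of_nat_sum)
    obtain X Y where XY: "X \<in> carrier_mat n n" "Y \<in> carrier_mat n n" "T = X * S * Y"
      using unimodularly_equivalent_factor[OF S(1) T(3)] by blast
    show "\<forall>l\<le>n. (\<Sum>i<l. f i) \<le> (\<Sum>i<l. g i)"
    proof (intro allI impI)
      fix l assume l: "l \<le> n"
      \<comment> \<open>The diagonal entries with the most factors of degree \<open>k\<close> have the fewest linear factors, so
        they give the sharpest bound.\<close>
      obtain I where I: "I \<subseteq> {..<n}" "card I = l" "(\<Sum>i<l. m i) \<le> (\<Sum>i\<in>I. e i)"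
        using homogeneous_prefix_le_top_sum[OF m_homogeneous e_total l] by blast
      have fin: "finite I" using I(1) finite_subset by blast
      have "(\<Prod>i<l. s i) dvd (\<Prod>i\<in>I. t i)"
        using prefix_prod_dvd_triangular_diagonal[OF XY(1) Sc XY(2) S(2) _ XY(3) T(1) I(1,2)] chain
        by (simp add: s_def t_def)
      moreover have nz: "s i \<noteq> 0" if "i \<in> {..<l}" for i using that l by (intro s_nz) simp
      moreover have nz': "t i \<noteq> 0" if "i \<in> I" for i using that I by (intro t_nz) auto
      ultimately have "?c 1 (\<Prod>i<l. s i) \<le> ?c 1 (\<Prod>i\<in>I. t i)"
        using fin by (intro size_mset_mono factors_of_degree_mono) auto
      then have "(\<Sum>i<l. ?c 1 (s i)) \<le> (\<Sum>i\<in>I. ?c 1 (t i))"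
        by (simp only: size_factors_of_degree_prod[OF finite_lessThan nz] size_factors_of_degree_prod[OF fin nz'])
      then have "int (\<Sum>i<l. ?c 1 (s i)) \<le> int (\<Sum>i\<in>I. ?c 1 (t i))" by (rule of_nat_mono)
      then have "(\<Sum>i<l. f i) \<le> (\<Sum>i\<in>I. int (?c 1 (t i)))" by (simp add: f_def)
      also have "\<dots> = (\<Sum>i\<in>I. int d - int k * e i)" using I c_e by (intro sum.cong) auto
      also have "\<dots> = int l * int d - int k * (\<Sum>i\<in>I. e i)"
        using I by (simp add: sum_subtractf sum_distrib_left)
      also have "\<dots> \<le> int l * int d - int k * (\<Sum>i<l. m i)"
        using I(3) by (simp add: mult_left_mono)
      also have "\<dots> = (\<Sum>i<l. g i)" by (simp add: g_def sum_subtractf sum_distrib_left)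
      finally show "(\<Sum>i<l. f i) \<le> (\<Sum>i<l. g i)" .
    qed
  qed
  finally show ?thesis by simp
qed

end
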